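(* Let $n\ge k>0$ be integers, let $P_{n+k+1}$ be a convex $(n+k+1)$-gon with a chosen vertex $v_0$, and label the vertices of $P_{n+k+1}$ clockwise by $1,2,\dots,n+k+1$ starting from $v_0$. Let $\mathrm{Dis}(P_{n+k+1})$ be the set of all $k$-dissections of $P_{n+k+1}$ and let $D_0$ be the minimal $k$-dissection. Put $$\mathcal{T}_{P_{n+k+1}}(X_{n+k+1})=\sum_{D\in\mathrm{Dis}(P_{n+k+1})}\beta^{\#|D\setminus D_0|}\prod_{d_{ij}\in D\setminus D_0,\ i<j}x_i,$$ where $d_{ij}$, $i<j$, denotes the diagonal joining the vertices labeled $i$ and $j$, to which the variable $x_i$ is attached. Then $$\mathcal{T}_{P_{n+k+1}}(X_{n+k+1})=\beta^{k(n-k)}\prod_{a=1}^{n}x_a^{\min(n-a+1,\,n-k)}\ \mathfrak{G}^{(\beta^{-1})}_{w_k^{(n)}}\bigl(x_1^{-1},\dots,x_n^{-1}\bigr),$$ where $w_k^{(n)}=1^k\times w_0^{(n-k)}\in\mathbb{S}_n$.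
   Context: A $k$-dissection of a convex $(n+k+1)$-gon is a collection of diagonals which contains no $(k+1)$-subset of pairwise crossing diagonals and is such that at least $2(k-1)$ diagonals of the collection come from each vertex of the $(n+k+1)$-gon. The minimal $k$-dissection $D_0$ is the set of diagonals connecting the vertices labeled $a$ and $\overline{a+r}$, where $2\le r\le k$, $1\le a\le n+k+1$, and for a positive integer $b$, $\overline{b}$ is the unique integer with $1\le\overline{b}\le n+k+1$ and $b\equiv\overline{b}\pmod{n+k+1}$. $w_k^{(n)}=1^k\times w_0^{(n-k)}\in\mathbb{S}_n$ is the permutation fixing $1,\dots,k$ and sending $k+a\mapsto n+1-a$ for $1\le a\le n-k$. $\beta$-Grothendieck polynomials: let $\mathrm{IdC}_m(\beta)$ be the associative $\mathbb{Z}[\beta]$-algebra with generators $e_1,\dots,e_{m-1}$ and relations $e_ie_j=e_je_i$ if $|i-j|\ge2$, $e_ie_je_i=e_je_ie_j$ if $|i-j|=1$, $e_i^2=\beta e_i$. For $w\in\mathbb{S}_m$ put $e_w=e_{i_1}\cdots e_{i_\ell}$ for any reduced word $w=s_{i_1}\cdots s_{i_\ell}$, where $s_i=(i,i+1)$. With commuting variables $x_i$ which commute with all $e_j$, $h_i(x)=1+xe_i$ and $A_i(x)=h_{m-1}(x)\cdots h_i(x)$, the polynomials $\mathfrak{G}_w^{(\beta)}$ are defined by $A_1(x_1)\cdots A_{m-1}(x_{m-1})=\sum_{w\in\mathbb{S}_m}\mathfrak{G}_w^{(\beta)}(x_1,\dots,x_{m-1})e_w$; $\mathfrak{G}_w^{(\beta^{-1})}$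 means that $\beta$ is replaced by $\beta^{-1}$.
   Formalization: The permutation is taken as 1^k × w_0 in S_{n+1} (fixing 1..k and reversing k+1..n+1) instead of w_k^{(n)} in S_n, and a k-dissection is additionally required to contain the minimal k-dissection D_0; as printed the identity fails, e.g. for n=2, k=1. *)

theory Defs
  imports
    "HOL-Library.Poly_Mapping"
    "HOL-Computational_Algebra.Polynomial_Factorial"
    "HOL-Combinatorics.Permutations"
    "HOL-Algebra.QuotRing"
begin

section \<open>Polynomials in the variables x over the integer polynomials in beta\<close>

type_synonym bxpoly = "(nat \<Rightarrow>\<^sub>0 nat) \<Rightarrow>\<^sub>0 int poly"

definition beta :: bxpoly
  where "beta = Poly_Mapping.single 0 [:0, 1:]"

definition var :: "nat \<Rightarrow> bxpoly"
  where "var i = Poly_Mapping.single (Poly_Mapping.single i 1) 1"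

text \<open>Substitution of \<open>b\<close> for beta and of \<open>x i\<close> for the \<open>i\<close>-th variable.\<close>

definition subst_bx :: "'a::comm_ring_1 \<Rightarrow> (nat \<Rightarrow> 'a) \<Rightarrow> bxpoly \<Rightarrow> 'a"
  where "subst_bx b x p =
    (\<Sum>\<mu>\<in>Poly_Mapping.keys p.
       poly (map_poly of_int (Poly_Mapping.lookup p \<mu>)) b *
       (\<Prod>i\<in>Poly_Mapping.keys \<mu>. x i ^ Poly_Mapping.lookup \<mu> i))"


section \<open>Dissections of a convex polygon\<close>

text \<open>The vertices of the convex \<open>N\<close>-gon are \<open>1, \<dots>, N\<close> in cyclic order. The diagonal joining
  \<open>i < j\<close> is the pair \<open>(i, j)\<close>; convexity enters only through the fact that two diagonals
  cross in their interiors iff their end points strictly interlace.\<close>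

definition diagonals :: "nat \<Rightarrow> (nat \<times> nat) set"
  where "diagonals N = {(i, j). 1 \<le> i \<and> i + 2 \<le> j \<and> j \<le> N \<and> (i, j) \<noteq> (1, N)}"

definition crossing :: "nat \<times> nat \<Rightarrow> nat \<times> nat \<Rightarrow> bool"
  where "crossing d d' \<longleftrightarrow>
    (fst d < fst d' \<and> fst d' < snd d \<and> snd d < snd d') \<or>
    (fst d' < fst d \<and> fst d < snd d' \<and> snd d' < snd d)"

text \<open>The representative of \<open>b \<ge> 1\<close> modulo \<open>N\<close> in \<open>{1..N}\<close>.\<close>

definition cyc :: "nat \<Rightarrow> nat \<Rightarrow> nat"
  where "cyc N b = (b - 1) mod N + 1"

definition minimal_dissection :: "nat \<Rightarrow> nat \<Rightarrow> (nat \<times> nat) set"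
  where "minimal_dissection k N =
    {(i, j). i < j \<and> (\<exists>a\<in>{1..N}. \<exists>r\<in>{2..k}. {i, j} = {a, cyc N (a + r)})}"

text \<open>The last condition says that the minimal dissection is the least one. It has to be
  imposed: for \<open>k \<ge> 2\<close> the other conditions do not entail it (in the hexagon, with \<open>k = 2\<close>,
  they are satisfied by all diagonals except \<open>(1, 3)\<close> and \<open>(2, 5)\<close>). In the presence of
  the last condition the degree condition holds automatically when \<open>N > 2 * k\<close>.\<close>

definition dissection :: "nat \<Rightarrow> nat \<Rightarrow> (nat \<times> nat) set \<Rightarrow> bool"
  where "dissection k N D \<longleftrightarrow>
    D \<subseteq> diagonals N \<and>
    \<not> (\<exists>S\<subseteq>D. card S = k + 1 \<and> (\<forall>d\<in>S. \<forall>d'\<in>S. d \<noteq> d' \<longrightarrow> crossing d d')) \<and>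
    (\<forall>v\<in>{1..N}. 2 * (k - 1) \<le> card {d \<in> D. v = fst d \<or> v = snd d}) \<and>
    minimal_dissection k N \<subseteq> D"

definition dissection_poly :: "nat \<Rightarrow> nat \<Rightarrow> bxpoly"
  where "dissection_poly k N =
    (\<Sum>D | dissection k N D.
       beta ^ card (D - minimal_dissection k N) *
       (\<Prod>d\<in>D - minimal_dissection k N. var (fst d)))"


section \<open>The algebra IdC\<close>

text \<open>The free monoid on the letters \<open>nat\<close>, written additively, so that
  \<^typ>\<open>'a \<Rightarrow>\<^sub>0 'b\<close> with \<open>'a\<close> this monoid is the free associative algebra.\<close>

datatype eword = Eword (letters: "nat list")

instantiation eword :: monoid_add
begin

definition zero_eword :: eword
  where "zero_eword = Eword []"

definition plus_eword :: "eword \<Rightarrow> eword \<Rightarrow> eword"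
  where "plus_eword u v = Eword (letters u @ letters v)"

instance
  by standard (simp_all add: zero_eword_def plus_eword_def)

end

text \<open>The coefficients already contain the variables x, which therefore commute with the
  generators: everything takes place in IdC with scalars extended from the integer polynomials
  in beta to \<^typ>\<open>bxpoly\<close>.\<close>

type_synonym ealg = "eword \<Rightarrow>\<^sub>0 bxpoly"

definition scal :: "bxpoly \<Rightarrow> ealg"
  where "scal c = Poly_Mapping.single 0 c"

definition emon :: "nat list \<Rightarrow> ealg"
  where "emon a = Poly_Mapping.single (Eword a) 1"

definition egen :: "nat \<Rightarrow> ealg"
  where "egen i = emon [i]"

definition free_alg :: "nat \<Rightarrow> ealg ring"
  where "free_alg m =
    \<lparr>carrier = {p. \<forall>u\<in>Poly_Mapping.keys p. set (letters u) \<subseteq> {1..<m}},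
     mult = (*), one = 1, zero = 0, add = (+)\<rparr>"

definition idc_relations :: "nat \<Rightarrow> ealg set"
  where "idc_relations m =
    {egen i * egen j - egen j * egen i | i j.
       i \<in> {1..<m} \<and> j \<in> {1..<m} \<and> (i + 2 \<le> j \<or> j + 2 \<le> i)} \<union>
    {egen i * egen j * egen i - egen j * egen i * egen j | i j.
       i \<in> {1..<m} \<and> j \<in> {1..<m} \<and> (j = i + 1 \<or> i = j + 1)} \<union>
    {egen i * egen i - scal beta * egen i | i. i \<in> {1..<m}}"

definition idc_ideal :: "nat \<Rightarrow> ealg set"
  where "idc_ideal m = Idl\<^bsub>free_alg m\<^esub> (idc_relations m)"

definition IdC :: "nat \<Rightarrow> ealg set ring"
  where "IdC m = free_alg m Quot idc_ideal m"

text \<open>The projection from the free algebra onto \<open>IdC m\<close>.\<close>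

definition idc_class :: "nat \<Rightarrow> ealg \<Rightarrow> ealg set"
  where "idc_class m p = idc_ideal m +>\<^bsub>free_alg m\<^esub> p"


section \<open>Beta-Grothendieck polynomials\<close>

definition word_for :: "nat \<Rightarrow> (nat \<Rightarrow> nat) \<Rightarrow> nat list \<Rightarrow> bool"
  where "word_for m w a \<longleftrightarrow>
    set a \<subseteq> {1..<m} \<and> w = foldr (\<lambda>i f. Transposition.transpose i (i + 1) \<circ> f) a id"

definition reduced_word :: "nat \<Rightarrow> (nat \<Rightarrow> nat) \<Rightarrow> nat list \<Rightarrow> bool"
  where "reduced_word m w a \<longleftrightarrow>
    word_for m w a \<and> (\<forall>b. word_for m w b \<longrightarrow> length a \<le> length b)"

text \<open>A representative in the free algebra; its class in \<open>IdC m\<close> does not depend on the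
  reduced word.\<close>

definition e_perm :: "nat \<Rightarrow> (nat \<Rightarrow> nat) \<Rightarrow> ealg"
  where "e_perm m w = emon (SOME a. reduced_word m w a)"

definition h_fac :: "nat \<Rightarrow> bxpoly \<Rightarrow> ealg"
  where "h_fac i y = 1 + scal y * egen i"

definition A_fac :: "nat \<Rightarrow> nat \<Rightarrow> bxpoly \<Rightarrow> ealg"
  where "A_fac m i y = prod_list (map (\<lambda>j. h_fac j y) (rev [i..<m]))"

text \<open>\<open>grothendieck m w\<close> is a polynomial in beta and \<open>x\<^sub>1, \<dots>, x\<^sub>m\<^sub>-\<^sub>1\<close>. The family is
  required to vanish outside of the symmetric group of \<open>{1..m}\<close> only to make it unique.\<close>

definition grothendieck :: "nat \<Rightarrow> (nat \<Rightarrow> nat) \<Rightarrow> bxpoly"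
  where "grothendieck m = (THE G.
    (\<forall>w. \<not> w permutes {1..m} \<longrightarrow> G w = 0) \<and>
    idc_class m (prod_list (map (\<lambda>i. A_fac m i (var i)) [1..<m])) =
    idc_class m (\<Sum>w | w permutes {1..m}. scal (G w) * e_perm m w))"

text \<open>The permutation \<open>1\<^sup>k \<times> w\<^sub>0\<close> of \<open>{1..m}\<close>: it fixes \<open>1, \<dots>, k\<close> and
  sends \<open>k + a\<close> to \<open>m + 1 - a\<close> for \<open>1 \<le> a \<le> m - k\<close>.\<close>

definition w_perm :: "nat \<Rightarrow> nat \<Rightarrow> nat \<Rightarrow> nat"
  where "w_perm k m i = (if k < i \<and> i \<le> m then m + 1 - (i - k) else i)"

text \<open>The identity between dissections of the \<open>(n + k + 1)\<close>-gon and Grothendieck polynomials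
  lives in the symmetric group of \<open>{1..n + 1}\<close>, whose Grothendieck polynomials have the \<open>n\<close>
  variables \<open>x\<^sub>1, \<dots>, x\<^sub>n\<close>; the permutation is \<open>w_perm k (n + 1)\<close>, that is, \<open>w\<^sub>0\<close> is the
  longest element of the symmetric group of rank \<open>n - k\<close>, on \<open>n - k + 1\<close> letters.
  With \<open>n - k\<close> letters the identity already fails for \<open>n = 2\<close>, \<open>k = 1\<close>: there the
  permutation would be trivial, while the left-hand side is \<open>1 + beta x\<^sub>1 + beta x\<^sub>2\<close>.\<close>

end

theory Submission
  imports Defs
begin

text \<open>
  Write \<open>N = n + k + 1\<close>. The product \<open>A\<^sub>1(x\<^sub>1) \<cdots> A\<^sub>n(x\<^sub>n)\<close> is a product of factors \<open>1 + x\<^sub>i e\<^sub>l\<close>,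
  one for each cell \<open>(i, l)\<close> of the triangle \<open>1 \<le> i \<le> l \<le> n\<close>, so that expanding it produces one
  word for each set \<open>T\<close> of cells. In the algebra, a word equals a power of beta times the basis
  element \<open>e\<^sub>w\<close>, where \<open>w\<close> is the Demazure (0-Hecke) product of its letters. A Grothendieck
  polynomial is therefore a sum over all \<open>T\<close> with a prescribed Demazure product
  (\<open>grothendieck_eq_sum\<close>). This rests on the fact that the \<open>e\<^sub>w\<close> form a basis: they span because
  every word can be rewritten to a normal word, and they are independent because the functionals
  \<open>hecke_coeff\<close>, which read a coefficient off the Demazure product, vanish on the ideal of
  relations.

  For \<open>w = 1\<^sup>k \<times> w\<^sub>0\<close> only cells with \<open>l > k\<close> can occur. Sending such a cell to the diagonal \<open>(i,
  N + i - l)\<close> identifies them with the diagonals that leave at least \<open>k\<close> vertices on both sides.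
  The other diagonals are exactly those of the minimal dissection, and they are never part of \<open>k +
  1\<close> pairwise crossing diagonals, so a dissection amounts to a set \<open>L\<close> of long diagonals without
  \<open>k + 1\<close> pairwise crossing ones (\<open>dissection_iff\<close>). The monomial in the variables \<open>x\<close> in front of
  the Grothendieck polynomial is that of all cells, so that multiplying by it turns the monomial
  of \<open>T\<close> in the inverse variables into the monomial of the complement of \<open>T\<close>; the powers of beta
  agree because there are \<open>k (n - k)\<close> more cells than inversions of the permutation
  (\<open>card_cells_inversions\<close>). What remains is a purely combinatorial equivalence: \<open>T\<close> has Demazure
  product \<open>1\<^sup>k \<times> w\<^sub>0\<close> iff the diagonals of the missing cells contain no \<open>k + 1\<close> pairwise crossing
  ones.

  The Demazure product is computed by bubble sort steps, and each of its rank numbers (how many of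
  the first \<open>q\<close> positions carry a value above \<open>p\<close>) changes only by being replaced by a minimum
  formed from the numbers for \<open>q - 1\<close> and \<open>q + 1\<close>. Hence it is governed by a recursion of the same
  kind as for longest common subsequences: up to a cap it is \<open>q\<close> minus the length of the longest
  chain of missing cells in a region that depends on \<open>p\<close> and \<open>q\<close>
  (\<open>rank_count_demazure_inv_subword\<close>). The permutation is \<open>1\<^sup>k \<times> w\<^sub>0\<close> iff for each \<open>p \<ge> k\<close> the
  region for \<open>q = n + k + 1 - p\<close> contains no chain of \<open>k + 1\<close> cells, and the chains of \<open>k + 1\<close>
  cells in that region are the families of \<open>k + 1\<close> pairwise crossing diagonals from \<open>{1..p}\<close> to
  \<open>{p + 1..N}\<close>. Any such family of long diagonals is of this form, for \<open>p\<close> its largest left end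
  point.
\<close>

section \<open>Demazure products by bubble sort\<close>

text \<open>Permutations are represented by their inverses, on which left multiplication by an adjacent
  transposition exchanges two neighbouring positions. The 0-Hecke action then becomes a sorting
  step that needs no case distinction (\<open>bubble_eq_max_min\<close>) and makes sense for all functions.\<close>

definition bubble :: "nat \<Rightarrow> (nat \<Rightarrow> nat) \<Rightarrow> nat \<Rightarrow> nat"
  where "bubble i u = (if u i < u (Suc i) then u \<circ> Transposition.transpose i (Suc i) else u)"

definition demazure_inv :: "nat list \<Rightarrow> nat \<Rightarrow> nat"
  where "demazure_inv a = foldr bubble a id"

definition inversions :: "nat \<Rightarrow> (nat \<Rightarrow> nat) \<Rightarrow> nat"
  where "inversions m u = card {(a, b). 1 \<le> a \<and> a < b \<and> b \<le> m \<and> u b < u a}"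

lemma bubble_eq_max_min:
  "bubble i u = u(i := max (u i) (u (Suc i)), Suc i := min (u i) (u (Suc i)))"
  by (auto simp: bubble_def fun_eq_iff Transposition.transpose_def)

lemma bubble_commute:
  assumes "i + 2 \<le> j \<or> j + 2 \<le> i"
  shows "bubble i (bubble j u) = bubble j (bubble i u)"
  using assms by (auto simp: bubble_eq_max_min fun_eq_iff)

text \<open>On three neighbouring positions both sides sort the values into decreasing order.\<close>

lemma bubble_braid_aux:
  "bubble i (bubble (Suc i) (bubble i u)) = bubble (Suc i) (bubble i (bubble (Suc i) u))"
  by (auto simp: bubble_eq_max_min fun_eq_iff max_def min_def)

lemma bubble_braid:
  assumes "j = i + 1 \<or> i = j + 1"
  shows "bubble i (bubble j (bubble i u)) = bubble j (bubble i (bubble j u))"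
  using assms bubble_braid_aux by auto

lemma bubble_idem: "bubble i (bubble i u) = bubble i u"
  by (auto simp: bubble_eq_max_min fun_eq_iff)

lemma demazure_inv_simps [simp]: "demazure_inv [] = id" "demazure_inv (i # a) = bubble i (demazure_inv a)"
  by (simp_all add: demazure_inv_def)

lemma demazure_inv_append: "demazure_inv (a @ b) = foldr bubble a (demazure_inv b)"
  by (simp add: demazure_inv_def)

lemma transpose_adjacent_permutes:
  assumes "i \<in> {1..<m}"
  shows "Transposition.transpose i (Suc i) permutes {1..m}"
  using assms by (intro permutes_swap_id) auto

lemma bubble_permutes:
  assumes "u permutes {1..m}" "i \<in> {1..<m}"
  shows "bubble i u permutes {1..m}"
  using assms transpose_adjacent_permutes[OF assms(2)]
  by (auto simp: bubble_def intro: permutes_compose)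

lemma demazure_inv_permutes:
  assumes "set a \<subseteq> {1..<m}"
  shows "demazure_inv a permutes {1..m}"
  using assms by (induction a) (simp_all add: bubble_permutes permutes_id del: One_nat_def)

lemma inversions_ascent:
  assumes "i \<in> {1..<m}" "u i < u (Suc i)"
  shows "inversions m (u \<circ> Transposition.transpose i (Suc i)) = Suc (inversions m u)"
proof -
  let ?s = "Transposition.transpose i (Suc i)"
  let ?I = "\<lambda>u. {(a, b). 1 \<le> a \<and> a < b \<and> b \<le> m \<and> u b < (u a :: nat)}"
  have fin: "finite (?I v)" for v
    by (rule finite_subset[of _ "{1..m} \<times> {1..m}"]) auto
  have "bij_betw (map_prod ?s ?s) (?I u) (?I (u \<circ> ?s) - {(i, Suc i)})"
  proof (rule bij_betw_byWitness[where f' = "map_prod ?s ?s"])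
    show "map_prod ?s ?s ` ?I u \<subseteq> ?I (u \<circ> ?s) - {(i, Suc i)}"
      using assms by (auto simp: Transposition.transpose_def split: if_splits)
    show "map_prod ?s ?s ` (?I (u \<circ> ?s) - {(i, Suc i)}) \<subseteq> ?I u"
      using assms by (auto simp: Transposition.transpose_def split: if_splits)
  qed auto
  then have "card (?I u) = card (?I (u \<circ> ?s) - {(i, Suc i)})"
    by (rule bij_betw_same_card)
  moreover have "(i, Suc i) \<in> ?I (u \<circ> ?s)"
    using assms by (auto simp: Transposition.transpose_def)
  from card.remove[OF fin this]
  have "card (?I (u \<circ> ?s)) = Suc (card (?I (u \<circ> ?s) - {(i, Suc i)}))" .
  ultimately show ?thesis
    unfolding inversions_def by simp
qed

lemma inversions_transpose_le:
  assumes "i \<in> {1..<m}" "u (Suc i) \<noteq> u i"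
  shows "inversions m (u \<circ> Transposition.transpose i (Suc i)) \<le> Suc (inversions m u)"
proof (cases "u i < u (Suc i)")
  case True
  then show ?thesis using inversions_ascent[of i m u] assms by simp
next
  case False
  let ?v = "u \<circ> Transposition.transpose i (Suc i)"
  have "?v i < ?v (Suc i)" using False assms by simp
  moreover have "?v \<circ> Transposition.transpose i (Suc i) = u"
    by (simp add: fun_eq_iff)
  ultimately show ?thesis
    using inversions_ascent[OF assms(1), of ?v] by simp
qed

lemma inversions_id [simp]: "inversions m id = 0"
proof -
  have "{(a, b). 1 \<le> a \<and> a < b \<and> b \<le> m \<and> id b < (id a :: nat)} = {}" by auto
  then show ?thesis unfolding inversions_def by (simp only: card.empty)
qed

lemma inversions_bubble_le:
  assumes "i \<in> {1..<m}"
  shows "inversions m (bubble i u) \<le> Suc (inversions m u)"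
  using inversions_ascent[OF assms, of u] by (auto simp: bubble_def)

lemma inversions_demazure_inv_le:
  assumes "set a \<subseteq> {1..<m}"
  shows "inversions m (demazure_inv a) \<le> length a"
  using assms
proof (induction a)
  case (Cons i a)
  then show ?case using inversions_bubble_le[of i m "demazure_inv a"] by simp
qed simp

definition word_perm_inv :: "nat list \<Rightarrow> nat \<Rightarrow> nat"
  where "word_perm_inv a = foldr (\<lambda>i u. u \<circ> Transposition.transpose i (Suc i)) a id"

lemma word_perm_inv_simps:
  "word_perm_inv [] = id" "word_perm_inv (i # a) = word_perm_inv a \<circ> Transposition.transpose i (Suc i)"
  by (simp_all only: word_perm_inv_def foldr_Nil foldr_Cons o_apply id_apply)

lemma word_perm_inv_permutes:
  assumes "set a \<subseteq> {1..<m}"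
  shows "word_perm_inv a permutes {1..m}"
  using assms
proof (induction a)
  case Nil
  show ?case unfolding word_perm_inv_simps by (rule permutes_id)
next
  case (Cons i a)
  then show ?case
    unfolding word_perm_inv_simps by (intro permutes_compose transpose_adjacent_permutes) simp_all
qed

lemma word_perm_inv_neq_Suc:
  assumes "set a \<subseteq> {1..<m}"
  shows "word_perm_inv a (Suc i) \<noteq> word_perm_inv a i"
  using permutes_inj[OF word_perm_inv_permutes[OF assms]] by (simp add: inj_eq)

lemma inversions_word_perm_inv_Cons_le:
  assumes "set (i # a) \<subseteq> {1..<m}"
  shows "inversions m (word_perm_inv (i # a)) \<le> Suc (inversions m (word_perm_inv a))"
  unfolding word_perm_inv_simps using assms by (intro inversions_transpose_le word_perm_inv_neq_Suc) auto

lemma inversions_word_perm_inv_le: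
  assumes "set a \<subseteq> {1..<m}"
  shows "inversions m (word_perm_inv a) \<le> length a"
  using assms
proof (induction a)
  case (Cons i a)
  then show ?case using inversions_word_perm_inv_Cons_le[OF Cons.prems] by simp
qed (simp_all add: word_perm_inv_simps bij_id[unfolded id_def])

lemma inversions_word_perm_inv_descent:
  assumes "set (i # a) \<subseteq> {1..<m}" "word_perm_inv a (Suc i) < word_perm_inv a i"
  shows "inversions m (word_perm_inv a) = Suc (inversions m (word_perm_inv (i # a)))"
proof -
  have "word_perm_inv (i # a) \<circ> Transposition.transpose i (Suc i) = word_perm_inv a"
    by (simp add: fun_eq_iff word_perm_inv_simps)
  moreover have "word_perm_inv (i # a) i < word_perm_inv (i # a) (Suc i)"
    using assms(2) by (simp add: word_perm_inv_simps)
  ultimately show ?thesis using inversions_ascent[of i m "word_perm_inv (i # a)"] assms(1) by simp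
qed

text \<open>For a reduced word every letter increases the number of inversions, so that each sorting step
  is a genuine transposition.\<close>

lemma demazure_inv_eq_word_perm_inv:
  assumes "set a \<subseteq> {1..<m}" "length a \<le> inversions m (word_perm_inv a)"
  shows "demazure_inv a = word_perm_inv a"
  using assms
proof (induction a)
  case (Cons i a)
  then have "length a \<le> inversions m (word_perm_inv a)"
    using inversions_word_perm_inv_Cons_le[OF Cons.prems(1)] by simp
  then have eq: "demazure_inv a = word_perm_inv a" using Cons by simp
  have "\<not> word_perm_inv a (Suc i) < word_perm_inv a i"
    using inversions_word_perm_inv_descent[OF Cons.prems(1)] inversions_word_perm_inv_le[of a m] Cons.prems by auto
  then have "word_perm_inv a i < word_perm_inv a (Suc i)"
    using word_perm_inv_neq_Suc[of a m i] Cons.prems by auto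
  then show ?case using eq by (simp add: bubble_def word_perm_inv_simps)
qed (simp_all add: word_perm_inv_simps bij_id[unfolded id_def])

abbreviation perm_inv :: "(nat \<Rightarrow> nat) \<Rightarrow> nat \<Rightarrow> nat"
  where "perm_inv w \<equiv> inv_into UNIV w"

lemma foldr_transpose_eq_word_perm_inv:
  "bij (foldr (\<lambda>i f. Transposition.transpose i (i + 1) \<circ> f) a id) \<and>
   word_perm_inv a = perm_inv (foldr (\<lambda>i f. Transposition.transpose i (i + 1) \<circ> f) a id)"
proof (induction a)
  case (Cons i a)
  let ?f = "foldr (\<lambda>i f. Transposition.transpose i (i + 1) \<circ> f) a id"
  have "perm_inv (Transposition.transpose i (i + 1) \<circ> ?f) =
      perm_inv ?f \<circ> perm_inv (Transposition.transpose i (i + 1))"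
    using conjunct1[OF Cons] by (intro o_inv_distrib bij_transpose)
  moreover have "bij (Transposition.transpose i (i + 1) \<circ> ?f)"
    using conjunct1[OF Cons] by (intro bij_comp bij_transpose)
  moreover have "perm_inv (Transposition.transpose i (i + 1)) = Transposition.transpose i (Suc i)"
    by simp
  ultimately have "bij (Transposition.transpose i (i + 1) \<circ> ?f) \<and>
      word_perm_inv (i # a) = perm_inv (Transposition.transpose i (i + 1) \<circ> ?f)"
    unfolding word_perm_inv_simps conjunct2[OF Cons] by metis
  then show ?case unfolding foldr_Cons o_apply .
qed (simp_all add: word_perm_inv_simps bij_id[unfolded id_def])

lemma word_for_iff_word_perm_inv:
  assumes "w permutes {1..m}"
  shows "word_for m w a \<longleftrightarrow> set a \<subseteq> {1..<m} \<and> word_perm_inv a = perm_inv w"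
proof -
  let ?f = "foldr (\<lambda>i f. Transposition.transpose i (i + 1) \<circ> f) a id"
  have "w = ?f \<longleftrightarrow> perm_inv ?f = perm_inv w"
    using foldr_transpose_eq_word_perm_inv[of a] permutes_bij[OF assms] inv_inv_eq by metis
  then show ?thesis
    using foldr_transpose_eq_word_perm_inv[of a] unfolding word_for_def by simp
qed

section \<open>The free algebra\<close>

definition lin_ext :: "(nat list \<Rightarrow> bxpoly) \<Rightarrow> ealg \<Rightarrow> bxpoly"
  where "lin_ext \<phi> p = (\<Sum>u\<in>Poly_Mapping.keys p. Poly_Mapping.lookup p u * \<phi> (letters u))"

lemma lin_ext_superset:
  assumes "finite S" "Poly_Mapping.keys p \<subseteq> S"
  shows "lin_ext \<phi> p = (\<Sum>u\<in>S. Poly_Mapping.lookup p u * \<phi> (letters u))"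
  unfolding lin_ext_def using assms
  by (intro sum.mono_neutral_left) (auto simp: in_keys_iff)

lemma lin_ext_add: "lin_ext \<phi> (p + q) = lin_ext \<phi> p + lin_ext \<phi> q"
proof -
  let ?S = "Poly_Mapping.keys p \<union> Poly_Mapping.keys q"
  have "Poly_Mapping.keys (p + q) \<subseteq> ?S" by (rule Poly_Mapping.keys_add)
  then show ?thesis
    by (simp add: lin_ext_superset[of ?S] lookup_add distrib_right sum.distrib)
qed

lemma lin_ext_zero [simp]: "lin_ext \<phi> 0 = 0"
  by (simp add: lin_ext_def)

lemma lin_ext_diff: "lin_ext \<phi> (p - q) = lin_ext \<phi> p - lin_ext \<phi> q"
  using lin_ext_add[of \<phi> "p - q" q] by simp

lemma lin_ext_sum: "lin_ext \<phi> (\<Sum>x\<in>A. f x) = (\<Sum>x\<in>A. lin_ext \<phi> (f x))"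
  by (induction A rule: infinite_finite_induct) (simp_all add: lin_ext_add)

lemma lin_ext_single: "lin_ext \<phi> (Poly_Mapping.single u c) = c * \<phi> (letters u)"
  by (simp add: lin_ext_def)

lemma lin_ext_emon [simp]: "lin_ext \<phi> (emon a) = \<phi> a"
  by (simp add: emon_def lin_ext_single)

lemma scal_mult_single: "scal c * Poly_Mapping.single u d = Poly_Mapping.single u (c * d)"
  by (simp add: scal_def mult_single)

lemma single_mult_scal: "Poly_Mapping.single u d * scal c = Poly_Mapping.single u (c * d)"
  by (simp add: scal_def mult_single mult.commute)

lemma ealg_expand:
  "p = (\<Sum>u\<in>Poly_Mapping.keys p. scal (Poly_Mapping.lookup p u) * emon (letters u))"
proof (rule poly_mapping_eqI)
  fix v
  have "(\<Sum>u\<in>Poly_Mapping.keys p. Poly_Mapping.lookup p u when u = v) = Poly_Mapping.lookup p v"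
    by (auto simp: when_def in_keys_iff)
  then show "Poly_Mapping.lookup p v = Poly_Mapping.lookup
      (\<Sum>u\<in>Poly_Mapping.keys p. scal (Poly_Mapping.lookup p u) * emon (letters u)) v"
    by (simp add: lookup_sum emon_def scal_mult_single lookup_single)
qed

lemma scal_mult: "scal (c * d) = scal c * scal d"
  by (simp add: scal_def mult_single)

lemma scal_one [simp]: "scal 1 = 1"
  by (simp add: scal_def)

lemma scal_zero [simp]: "scal 0 = 0"
  by (simp add: scal_def)

lemma scal_add: "scal (c + d) = scal c + scal d"
  by (simp add: scal_def single_add)

lemma scal_sum: "scal (\<Sum>x\<in>A. f x) = (\<Sum>x\<in>A. scal (f x))"
  by (induction A rule: infinite_finite_induct) (simp_all add: scal_add)

lemma emon_append: "emon (a @ b) = emon a * emon b"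
  by (simp add: emon_def mult_single plus_eword_def)

lemma emon_Nil [simp]: "emon [] = 1"
  by (simp add: emon_def flip: zero_eword_def)

lemma emon_mult_scal: "emon a * scal c = scal c * emon a"
  by (simp add: emon_def scal_mult_single single_mult_scal)

text \<open>The scalars are central although the free algebra is not commutative.\<close>

lemma scal_commute: "p * scal c = scal c * p"
proof -
  have "p * scal c = (\<Sum>u\<in>Poly_Mapping.keys p. scal (Poly_Mapping.lookup p u) * emon (letters u)) * scal c"
    by (subst ealg_expand) (rule refl)
  also have "\<dots> = scal c * (\<Sum>u\<in>Poly_Mapping.keys p. scal (Poly_Mapping.lookup p u) * emon (letters u))"
    unfolding sum_distrib_left sum_distrib_right
  proof (rule sum.cong[OF refl])
    fix u
    show "scal (Poly_Mapping.lookup p u) * emon (letters u) * scal c =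
      scal c * (scal (Poly_Mapping.lookup p u) * emon (letters u))"
      by (simp only: mult.assoc emon_mult_scal) (simp only: mult.assoc[symmetric] scal_mult[symmetric] mult.commute)
  qed
  also have "\<dots> = scal c * p" by (simp flip: ealg_expand)
  finally show ?thesis .
qed

lemma lin_ext_scal: "lin_ext \<phi> (scal c * p) = c * lin_ext \<phi> p"
proof -
  have "scal c * p = (\<Sum>u\<in>Poly_Mapping.keys p. Poly_Mapping.single u (c * Poly_Mapping.lookup p u))"
    by (subst ealg_expand) (simp add: sum_distrib_left emon_def scal_mult_single)
  then have "lin_ext \<phi> (scal c * p) =
      (\<Sum>u\<in>Poly_Mapping.keys p. c * Poly_Mapping.lookup p u * \<phi> (letters u))"
    by (simp only: lin_ext_sum lin_ext_single)
  then show ?thesis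
    by (simp only: lin_ext_def sum_distrib_left mult.assoc)
qed

section \<open>The free algebra as a ring and the ideal of relations\<close>

lemma free_alg_simps [simp]:
  "mult (free_alg m) = (*)" "one (free_alg m) = 1" "zero (free_alg m) = 0" "add (free_alg m) = (+)"
  by (simp_all add: free_alg_def)

lemma carrier_free_alg_iff:
  "p \<in> carrier (free_alg m) \<longleftrightarrow> (\<forall>u\<in>Poly_Mapping.keys p. set (letters u) \<subseteq> {1..<m})"
  by (simp add: free_alg_def)

lemma carrier_single:
  "set (letters u) \<subseteq> {1..<m} \<Longrightarrow> Poly_Mapping.single u c \<in> carrier (free_alg m)"
  by (simp add: carrier_free_alg_iff)

lemma carrier_emon: "set a \<subseteq> {1..<m} \<Longrightarrow> emon a \<in> carrier (free_alg m)"
  by (simp add: emon_def carrier_single)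

lemma carrier_scal: "scal c \<in> carrier (free_alg m)"
  by (simp add: scal_def carrier_single zero_eword_def)

lemma carrier_add:
  "p \<in> carrier (free_alg m) \<Longrightarrow> q \<in> carrier (free_alg m) \<Longrightarrow> p + q \<in> carrier (free_alg m)"
  unfolding carrier_free_alg_iff using Poly_Mapping.keys_add[of p q] by blast

lemma carrier_mult:
  "p \<in> carrier (free_alg m) \<Longrightarrow> q \<in> carrier (free_alg m) \<Longrightarrow> p * q \<in> carrier (free_alg m)"
  unfolding carrier_free_alg_iff using keys_mult[of p q] by (fastforce simp: plus_eword_def)

lemma carrier_uminus: "p \<in> carrier (free_alg m) \<Longrightarrow> - p \<in> carrier (free_alg m)"
  by (simp add: carrier_free_alg_iff in_keys_iff)

lemma carrier_one: "1 \<in> carrier (free_alg m)"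
  using carrier_scal[of 1] by simp

lemma carrier_zero: "0 \<in> carrier (free_alg m)"
  using carrier_scal[of 0] by simp

lemma carrier_diff:
  "p \<in> carrier (free_alg m) \<Longrightarrow> q \<in> carrier (free_alg m) \<Longrightarrow> p - q \<in> carrier (free_alg m)"
  using carrier_add[OF _ carrier_uminus, of p m q] by simp

lemma carrier_sum:
  "(\<And>x. x \<in> A \<Longrightarrow> f x \<in> carrier (free_alg m)) \<Longrightarrow> sum f A \<in> carrier (free_alg m)"
  by (induction A rule: infinite_finite_induct) (simp_all add: carrier_zero carrier_add)

lemma carrier_prod_list:
  "(\<And>x. x \<in> set xs \<Longrightarrow> x \<in> carrier (free_alg m)) \<Longrightarrow> prod_list xs \<in> carrier (free_alg m)"
  by (induction xs) (simp_all add: carrier_one carrier_mult)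

lemmas carrier_intros = carrier_emon carrier_scal carrier_add carrier_mult carrier_uminus
  carrier_one carrier_zero carrier_diff

lemma free_alg_ring: "ring (free_alg m)"
proof (rule ringI)
  show "abelian_group (free_alg m)"
  proof (rule abelian_groupI)
    fix x assume "x \<in> carrier (free_alg m)"
    then show "\<exists>y\<in>carrier (free_alg m). y \<oplus>\<^bsub>free_alg m\<^esub> x = \<zero>\<^bsub>free_alg m\<^esub>"
      by (intro bexI[of _ "- x"]) (simp_all add: carrier_uminus)
  qed (simp_all add: carrier_add carrier_zero add.assoc add.commute)
  show "Group.monoid (free_alg m)"
    by (rule monoidI) (simp_all add: carrier_mult carrier_one mult.assoc)
qed (simp_all add: distrib_left distrib_right)

lemma free_alg_a_inv:
  assumes "x \<in> carrier (free_alg m)"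
  shows "\<ominus>\<^bsub>free_alg m\<^esub> x = - x"
proof -
  interpret R: ring "free_alg m" by (rule free_alg_ring)
  show ?thesis using assms by (intro R.minus_equality) (simp_all add: carrier_uminus)
qed

lemma free_alg_a_minus:
  assumes "x \<in> carrier (free_alg m)" "y \<in> carrier (free_alg m)"
  shows "x \<ominus>\<^bsub>free_alg m\<^esub> y = x - y"
  using assms by (simp add: a_minus_def free_alg_a_inv)

lemma idc_relations_carrier: "idc_relations m \<subseteq> carrier (free_alg m)"
  unfolding idc_relations_def egen_def
  by (auto intro!: carrier_intros)

lemma idc_ideal_ideal: "ideal (idc_ideal m) (free_alg m)"
  unfolding idc_ideal_def by (rule ring.genideal_ideal[OF free_alg_ring idc_relations_carrier])

lemma idc_ideal_gen: "x \<in> idc_relations m \<Longrightarrow> x \<in> idc_ideal m"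
  unfolding idc_ideal_def using ring.genideal_self[OF free_alg_ring idc_relations_carrier] by blast

lemma idc_ideal_add: "x \<in> idc_ideal m \<Longrightarrow> y \<in> idc_ideal m \<Longrightarrow> x + y \<in> idc_ideal m"
  using additive_subgroup.a_closed[OF ideal.axioms(1)[OF idc_ideal_ideal[of m]]] by simp

lemma idc_ideal_zero: "0 \<in> idc_ideal m"
  using additive_subgroup.zero_closed[OF ideal.axioms(1)[OF idc_ideal_ideal[of m]]] by simp

lemma idc_ideal_lmult:
  "x \<in> idc_ideal m \<Longrightarrow> y \<in> carrier (free_alg m) \<Longrightarrow> y * x \<in> idc_ideal m"
  using ideal.I_l_closed[OF idc_ideal_ideal[of m]] by simp

lemma idc_ideal_rmult:
  "x \<in> idc_ideal m \<Longrightarrow> y \<in> carrier (free_alg m) \<Longrightarrow> x * y \<in> idc_ideal m"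
  using ideal.I_r_closed[OF idc_ideal_ideal[of m]] by simp

lemma idc_ideal_uminus: "x \<in> idc_ideal m \<Longrightarrow> - x \<in> idc_ideal m"
  using idc_ideal_lmult[OF _ carrier_uminus[OF carrier_one], of x m] by simp

lemma idc_ideal_sum:
  "(\<And>x. x \<in> A \<Longrightarrow> f x \<in> idc_ideal m) \<Longrightarrow> sum f A \<in> idc_ideal m"
  by (induction A rule: infinite_finite_induct) (simp_all add: idc_ideal_zero idc_ideal_add)

lemma idc_class_eq_iff:
  assumes "p \<in> carrier (free_alg m)" "q \<in> carrier (free_alg m)"
  shows "idc_class m p = idc_class m q \<longleftrightarrow> p - q \<in> idc_ideal m"
  using ring.quotient_eq_iff_same_a_r_cos[OF free_alg_ring idc_ideal_ideal assms]
    free_alg_a_minus[OF assms]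
  unfolding idc_class_def by simp

section \<open>Functionals that vanish on the relations\<close>

text \<open>The coefficient of a basis element of the algebra in the class of a word; \<open>u\<close> is the inverse
  of the permutation of the basis element.\<close>

definition hecke_coeff :: "nat \<Rightarrow> (nat \<Rightarrow> nat) \<Rightarrow> nat list \<Rightarrow> bxpoly"
  where "hecke_coeff m u a = (if demazure_inv a = u then beta ^ (length a - inversions m u) else 0)"

text \<open>Multiplying by words on both sides makes this common kernel a two-sided ideal, which
  the kernel of a single functional need not be.\<close>

definition hecke_null :: "nat \<Rightarrow> ealg set"
  where "hecke_null m = {p \<in> carrier (free_alg m). \<forall>a b u.
     set a \<subseteq> {1..<m} \<longrightarrow> set b \<subseteq> {1..<m} \<longrightarrow> lin_ext (hecke_coeff m u) (emon a * p * emon b) = 0}"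

lemma emon_mult_expand:
  "emon a * x = (\<Sum>y\<in>Poly_Mapping.keys x. scal (Poly_Mapping.lookup x y) * emon (a @ letters y))"
proof -
  have "emon a * x = (\<Sum>y\<in>Poly_Mapping.keys x. emon a * (scal (Poly_Mapping.lookup x y) * emon (letters y)))"
    by (subst ealg_expand) (rule sum_distrib_left)
  then show ?thesis
    by (simp only: mult.assoc[symmetric] emon_mult_scal) (simp only: mult.assoc emon_append)
qed

lemma mult_emon_expand:
  "x * emon b = (\<Sum>y\<in>Poly_Mapping.keys x. scal (Poly_Mapping.lookup x y) * emon (letters y @ b))"
proof -
  have "x * emon b = (\<Sum>y\<in>Poly_Mapping.keys x. scal (Poly_Mapping.lookup x y) * emon (letters y) * emon b)"
    by (subst ealg_expand) (rule sum_distrib_right)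
  then show ?thesis
    by (simp only: mult.assoc emon_append)
qed

lemma hecke_null_ideal: "ideal (hecke_null m) (free_alg m)"
proof (rule idealI[OF free_alg_ring])
  show "subgroup (hecke_null m) (add_monoid (free_alg m))"
  proof
    fix x assume x: "x \<in> hecke_null m"
    then have "x \<in> carrier (free_alg m)" by (simp add: hecke_null_def)
    then have "inv\<^bsub>add_monoid (free_alg m)\<^esub> x = - x"
      using free_alg_a_inv by (simp add: a_inv_def)
    moreover have "- x \<in> hecke_null m"
      using x lin_ext_diff[of _ 0] by (auto simp: hecke_null_def carrier_uminus)
    ultimately show "inv\<^bsub>add_monoid (free_alg m)\<^esub> x \<in> hecke_null m" by simp
  qed (auto simp: hecke_null_def carrier_zero carrier_add distrib_left distrib_right lin_ext_add)
next
  fix p x assume p: "p \<in> hecke_null m" and x: "x \<in> carrier (free_alg m)"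
  then have pc: "p \<in> carrier (free_alg m)" by (simp add: hecke_null_def)
  have null: "lin_ext (hecke_coeff m u) (emon a * p * emon b) = 0"
    if "set a \<subseteq> {1..<m}" "set b \<subseteq> {1..<m}" for a b u
    using p that by (auto simp: hecke_null_def)
  have l: "lin_ext (hecke_coeff m u) (emon a * (x * p) * emon b) = 0"
    if ab: "set a \<subseteq> {1..<m}" "set b \<subseteq> {1..<m}" for a b u
  proof -
    have "emon a * (x * p) * emon b = (emon a * x) * (p * emon b)"
      by (simp only: mult.assoc)
    also have "\<dots> = (\<Sum>y\<in>Poly_Mapping.keys x.
        scal (Poly_Mapping.lookup x y) * (emon (a @ letters y) * p * emon b))"
      unfolding emon_mult_expand[of a x] sum_distrib_right by (simp only: mult.assoc)
    finally show ?thesis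
      using x ab by (auto simp: lin_ext_sum lin_ext_scal null carrier_free_alg_iff intro!: sum.neutral)
  qed
  have r: "lin_ext (hecke_coeff m u) (emon a * (p * x) * emon b) = 0"
    if ab: "set a \<subseteq> {1..<m}" "set b \<subseteq> {1..<m}" for a b u
  proof -
    have "emon a * (p * x) * emon b = emon a * p * (x * emon b)"
      by (simp only: mult.assoc)
    also have "\<dots> = (\<Sum>y\<in>Poly_Mapping.keys x.
        emon a * p * scal (Poly_Mapping.lookup x y) * emon (letters y @ b))"
      unfolding mult_emon_expand[of x b] sum_distrib_left by (simp only: mult.assoc)
    also have "\<dots> = (\<Sum>y\<in>Poly_Mapping.keys x.
        scal (Poly_Mapping.lookup x y) * (emon a * p * emon (letters y @ b)))"
      unfolding scal_commute[of "emon a * p"] by (simp only: mult.assoc)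
    finally show ?thesis
      using x ab by (auto simp: lin_ext_sum lin_ext_scal null carrier_free_alg_iff intro!: sum.neutral)
  qed
  show "x \<otimes>\<^bsub>free_alg m\<^esub> p \<in> hecke_null m"
    using l x pc by (auto simp: hecke_null_def carrier_mult)
  show "p \<otimes>\<^bsub>free_alg m\<^esub> x \<in> hecke_null m"
    using r x pc by (auto simp: hecke_null_def carrier_mult)
qed

lemma hecke_coeff_square:
  assumes "set (a @ [i] @ b) \<subseteq> {1..<m}"
  shows "hecke_coeff m u (a @ [i, i] @ b) = beta * hecke_coeff m u (a @ [i] @ b)"
proof -
  have "demazure_inv (a @ [i, i] @ b) = demazure_inv (a @ [i] @ b)"
    by (simp add: demazure_inv_append bubble_idem)
  moreover have "inversions m (demazure_inv (a @ [i] @ b)) \<le> length (a @ [i] @ b)"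
    by (rule inversions_demazure_inv_le[OF assms])
  ultimately show ?thesis
    by (auto simp: hecke_coeff_def Suc_diff_le)
qed

text \<open>The commutation and braid relations hold for the sorting steps, and both sides of each have the
  same length. In the square relation the shorter word loses one letter but no inversion, which
  costs exactly one factor beta.\<close>

lemma idc_relations_null: "idc_relations m \<subseteq> hecke_null m"
proof
  fix r assume r: "r \<in> idc_relations m"
  have "lin_ext (hecke_coeff m u) (emon a * r * emon b) = 0"
    if ab: "set a \<subseteq> {1..<m}" "set b \<subseteq> {1..<m}" for a b u
  proof -
    have e2: "emon a * (egen i * egen j) * emon b = emon (a @ [i, j] @ b)" for i j
      by (simp add: egen_def emon_append[symmetric])
    have e3: "emon a * (egen i * egen j * egen k) * emon b = emon (a @ [i, j, k] @ b)" for i j k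
      by (simp add: egen_def emon_append[symmetric])
    have e1: "emon a * (scal beta * egen i) * emon b = scal beta * emon (a @ [i] @ b)" for i
      by (simp only: emon_append egen_def mult.assoc[symmetric] emon_mult_scal)
    from r consider
      (comm) i j where "r = egen i * egen j - egen j * egen i" "i + 2 \<le> j \<or> j + 2 \<le> i"
    | (braid) i j where "r = egen i * egen j * egen i - egen j * egen i * egen j" "j = i + 1 \<or> i = j + 1"
    | (square) i where "r = egen i * egen i - scal beta * egen i" "i \<in> {1..<m}"
      unfolding idc_relations_def by blast
    then show ?thesis
    proof cases
      case comm
      then show ?thesis
        by (simp only: right_diff_distrib left_diff_distrib e2 lin_ext_diff lin_ext_emon)
          (simp add: hecke_coeff_def demazure_inv_append bubble_commute[OF comm(2)])
    next
      case braid
      then show ?thesis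
        by (simp only: right_diff_distrib left_diff_distrib e3 lin_ext_diff lin_ext_emon)
          (simp add: hecke_coeff_def demazure_inv_append bubble_braid[OF braid(2)])
    next
      case square
      have "hecke_coeff m u (a @ [i, i] @ b) = beta * hecke_coeff m u (a @ [i] @ b)"
        using square ab by (intro hecke_coeff_square) auto
      then show ?thesis unfolding square
        by (simp only: right_diff_distrib left_diff_distrib e2 e1 lin_ext_diff lin_ext_scal lin_ext_emon diff_self)
    qed
  qed
  then show "r \<in> hecke_null m"
    using subsetD[OF idc_relations_carrier r] by (auto simp: hecke_null_def)
qed

lemma lin_ext_hecke_coeff_ideal:
  assumes "p \<in> idc_ideal m"
  shows "lin_ext (hecke_coeff m u) p = 0"
proof -
  have "idc_ideal m \<subseteq> hecke_null m"
    unfolding idc_ideal_def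
    by (rule ring.genideal_minimal[OF free_alg_ring hecke_null_ideal idc_relations_null])
  then have "p \<in> hecke_null m" using assms by blast
  then have "lin_ext (hecke_coeff m u) (emon [] * p * emon []) = 0"
    unfolding hecke_null_def by (metis (mono_tags, lifting) empty_subsetI list.set(1) mem_Collect_eq)
  then show ?thesis by simp
qed

section \<open>Rewriting words to normal form\<close>

(* Index sets such as {1..m} and runs [j..<Suc m] are kept in this shape throughout. *)
declare One_nat_def [simp del] upt_Suc [simp del]

text \<open>The word \<open>a\<close> is equal to \<open>b\<close> in the algebra up to \<open>c\<close> factors beta.\<close>

definition idc_eq :: "nat \<Rightarrow> nat \<Rightarrow> nat list \<Rightarrow> nat list \<Rightarrow> bool"
  where "idc_eq m c a b \<longleftrightarrow> emon a - scal (beta ^ c) * emon b \<in> idc_ideal m"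

lemma idc_eq_refl: "idc_eq m 0 a a"
  by (simp add: idc_eq_def idc_ideal_zero)

lemma idc_eq_trans:
  assumes "idc_eq m c a b" "idc_eq m d b e"
  shows "idc_eq m (c + d) a e"
proof -
  have "emon a - scal (beta ^ c) * emon b +
      scal (beta ^ c) * (emon b - scal (beta ^ d) * emon e) \<in> idc_ideal m"
    using assms by (auto simp: idc_eq_def intro: idc_ideal_add idc_ideal_lmult carrier_scal)
  moreover have "emon a - scal (beta ^ c) * emon b +
      scal (beta ^ c) * (emon b - scal (beta ^ d) * emon e) =
      emon a - scal (beta ^ (c + d)) * emon e"
    by (simp add: right_diff_distrib power_add scal_mult mult.assoc)
  ultimately show ?thesis by (simp add: idc_eq_def)
qed

lemma idc_eq_trans0:
  "idc_eq m 0 a b \<Longrightarrow> idc_eq m c b e \<Longrightarrow> idc_eq m c a e"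
  using idc_eq_trans[of m 0 a b c e] by simp

lemma idc_eq_context:
  assumes "idc_eq m c a b" "set u \<subseteq> {1..<m}" "set v \<subseteq> {1..<m}"
  shows "idc_eq m c (u @ a @ v) (u @ b @ v)"
proof -
  have "emon u * ((emon a - scal (beta ^ c) * emon b) * emon v) \<in> idc_ideal m"
    using assms
    by (intro idc_ideal_lmult[OF idc_ideal_rmult] carrier_emon) (simp_all add: idc_eq_def)
  moreover have "emon u * ((emon a - scal (beta ^ c) * emon b) * emon v) =
      emon (u @ a @ v) - scal (beta ^ c) * emon (u @ b @ v)"
  proof -
    have "emon u * (scal (beta ^ c) * emon b * emon v) = scal (beta ^ c) * emon (u @ b @ v)"
      by (simp only: emon_append mult.assoc[symmetric] emon_mult_scal)
    then show ?thesis
      by (simp only: left_diff_distrib right_diff_distrib) (simp only: emon_append)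
  qed
  ultimately show ?thesis by (simp add: idc_eq_def)
qed

lemma idc_eq_Cons:
  "idc_eq m c a b \<Longrightarrow> i \<in> {1..<m} \<Longrightarrow> idc_eq m c (i # a) (i # b)"
  using idc_eq_context[of m c a b "[i]" "[]"] by simp

lemma idc_eq_append:
  "idc_eq m c a b \<Longrightarrow> set v \<subseteq> {1..<m} \<Longrightarrow> idc_eq m c (a @ v) (b @ v)"
  using idc_eq_context[of m c a b "[]" v] by simp

lemma idc_eq_prepend:
  "idc_eq m c a b \<Longrightarrow> set v \<subseteq> {1..<m} \<Longrightarrow> idc_eq m c (v @ a) (v @ b)"
  using idc_eq_context[of m c a b v "[]"] by simp

lemma idc_eq_commute:
  assumes "i \<in> {1..<m}" "j \<in> {1..<m}" "i + 2 \<le> j \<or> j + 2 \<le> i"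
  shows "idc_eq m 0 [i, j] [j, i]"
proof -
  have "egen i * egen j - egen j * egen i \<in> idc_relations m"
    unfolding idc_relations_def using assms by blast
  then show ?thesis
    using idc_ideal_gen by (simp add: idc_eq_def egen_def flip: emon_append)
qed

lemma idc_eq_braid:
  assumes "i \<in> {1..<m}" "j \<in> {1..<m}" "j = i + 1 \<or> i = j + 1"
  shows "idc_eq m 0 [i, j, i] [j, i, j]"
proof -
  have "egen i * egen j * egen i - egen j * egen i * egen j \<in> idc_relations m"
    unfolding idc_relations_def using assms by blast
  then show ?thesis
    using idc_ideal_gen by (simp add: idc_eq_def egen_def flip: emon_append)
qed

lemma idc_eq_square:
  assumes "i \<in> {1..<m}"
  shows "idc_eq m 1 [i, i] [i]"
proof -
  have "egen i * egen i - scal beta * egen i \<in> idc_relations m"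
    unfolding idc_relations_def using assms by blast
  then show ?thesis
    using idc_ideal_gen by (simp add: idc_eq_def egen_def flip: emon_append)
qed

lemma idc_eq_commute_word:
  assumes "i \<in> {1..<m}" "set r \<subseteq> {1..<m}" "\<forall>j\<in>set r. i + 2 \<le> j \<or> j + 2 \<le> i"
  shows "idc_eq m 0 (i # r) (r @ [i])"
  using assms(2,3)
proof (induction r)
  case Nil
  then show ?case by (simp add: idc_eq_refl)
next
  case (Cons j r)
  have "idc_eq m 0 ([i, j] @ r) ([j, i] @ r)"
    using Cons.prems assms(1) by (intro idc_eq_append idc_eq_commute) auto
  moreover have "idc_eq m 0 (j # i # r) (j # r @ [i])"
    using Cons by (intro idc_eq_Cons) auto
  ultimately show ?case by (auto intro: idc_eq_trans0)
qed

text \<open>One reduced word for each permutation of \<open>{1..m}\<close>: in the step to \<open>Suc m\<close>, the run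
  \<open>j, \<dots>, m\<close> carries \<open>Suc m\<close> to \<open>j\<close>, and the remaining letters permute \<open>{1..m}\<close>.\<close>

primrec normal_words :: "nat \<Rightarrow> nat list set"
  where
    "normal_words 0 = {[]}"
  | "normal_words (Suc m) =
      {[j..<Suc m] @ b | j b. 1 \<le> j \<and> j \<le> Suc m \<and> b \<in> normal_words m}"

lemma normal_wordsE:
  assumes "b \<in> normal_words (Suc m)"
  obtains j b' where "b = [j..<Suc m] @ b'" "1 \<le> j" "j \<le> Suc m" "b' \<in> normal_words m"
  using assms by auto

lemma normal_wordsI:
  "1 \<le> j \<Longrightarrow> j \<le> Suc m \<Longrightarrow> b \<in> normal_words m \<Longrightarrow> [j..<Suc m] @ b \<in> normal_words (Suc m)"
  by auto

lemma normal_words_letters: "b \<in> normal_words m \<Longrightarrow> set b \<subseteq> {1..<m}"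
proof (induction m arbitrary: b)
  case (Suc m)
  from Suc.prems obtain j b' where "b = [j..<Suc m] @ b'" "1 \<le> j" "b' \<in> normal_words m"
    by (rule normal_wordsE)
  then show ?case using Suc.IH[of b'] by auto
qed simp

lemma Nil_normal_word: "[] \<in> normal_words m"
proof (induction m)
  case (Suc m)
  then show ?case using normal_wordsI[of "Suc m" m "[]"] by simp
qed simp

text \<open>A letter \<open>i\<close> in front of a run \<open>j, \<dots>, m\<close> commutes with the run (\<open>i + 1 < j\<close>), extends it
  (\<open>i + 1 = j\<close>), is absorbed by the square relation (\<open>i = j\<close>), or passes through it by a braid
  relation, leaving it on the right as \<open>i - 1\<close> (\<open>j < i\<close>). What comes out on the right is absorbed
  by the rest of the word by induction. The relations are those of a fixed larger algebra \<open>M\<close>, so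
  that the induction can lower \<open>m\<close>.\<close>

lemma letter_normal_word:
  assumes "m \<le> M" "i \<in> {1..<m}" "b \<in> normal_words m"
  shows "\<exists>c b'. b' \<in> normal_words m \<and> idc_eq M c (i # b) b'"
  using assms
proof (induction m arbitrary: i b)
  case (Suc m)
  obtain j b' where b: "b = [j..<Suc m] @ b'" "1 \<le> j" "j \<le> Suc m" "b' \<in> normal_words m"
    using Suc.prems(3) by (rule normal_wordsE)
  have iM: "i \<in> {1..<M}" using Suc.prems by auto
  have run: "set [j..<Suc m] \<subseteq> {1..<M}" using b Suc.prems by auto
  have b'M: "set b' \<subseteq> {1..<M}" using normal_words_letters[OF b(4)] Suc.prems by auto
  have move: "\<exists>c b''. b'' \<in> normal_words (Suc m) \<and> idc_eq M c (i # b) b''"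
    if l: "l \<in> {1..<m}" "idc_eq M 0 (i # [j..<Suc m]) ([j..<Suc m] @ [l])" for l
  proof -
    obtain c b'' where IH: "b'' \<in> normal_words m" "idc_eq M c (l # b') b''"
      using Suc.IH[of l b'] Suc.prems(1) l(1) b(4) by auto
    have "idc_eq M 0 (i # b) ([j..<Suc m] @ l # b')"
      using idc_eq_append[OF l(2) b'M] by (simp add: b)
    moreover have "idc_eq M c ([j..<Suc m] @ l # b') ([j..<Suc m] @ b'')"
      by (rule idc_eq_prepend[OF IH(2) run])
    ultimately have "idc_eq M c (i # b) ([j..<Suc m] @ b'')"
      by (rule idc_eq_trans0)
    then show ?thesis using normal_wordsI[OF b(2,3) IH(1)] by blast
  qed
  consider "Suc i < j" | "Suc i = j" | "i = j" | "j < i" by linarith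
  then show ?case
  proof cases
    case 1
    have "idc_eq M 0 (i # [j..<Suc m]) ([j..<Suc m] @ [i])"
      using 1 by (intro idc_eq_commute_word iM run) auto
    then show ?thesis using 1 b Suc.prems by (intro move) auto
  next
    case 2
    have "i # b = [i..<Suc m] @ b'"
      using 2 Suc.prems b by (simp add: upt_conv_Cons)
    moreover have "[i..<Suc m] @ b' \<in> normal_words (Suc m)"
      using 2 b Suc.prems by (intro normal_wordsI) auto
    ultimately show ?thesis using idc_eq_refl by metis
  next
    case 3
    have eq: "b = [i] @ ([Suc i..<Suc m] @ b')"
      using 3 Suc.prems b by (simp add: upt_conv_Cons)
    have "idc_eq M 1 ([i, i] @ ([Suc i..<Suc m] @ b')) ([i] @ ([Suc i..<Suc m] @ b'))"
      using iM run b'M 3 by (intro idc_eq_append idc_eq_square) auto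
    then have "idc_eq M 1 (i # b) b" by (simp add: eq)
    then show ?thesis using Suc.prems(3) by blast
  next
    case 4
    define l where "l = i - 1"
    have l: "i = Suc l" "j \<le> l" "l < m" using 4 Suc.prems by (auto simp: l_def)
    have eq: "[j..<Suc m] = [j..<l] @ [l, i] @ [Suc i..<Suc m]"
      using l upt_add_eq_append[of j l "Suc m - l"] by (simp add: upt_conv_Cons)
    have r1: "set [j..<l] \<subseteq> {1..<M}" and r2: "set [Suc i..<Suc m] \<subseteq> {1..<M}"
      using run unfolding eq by auto
    have lM: "l \<in> {1..<M}" using l b(2) iM by auto
    have "idc_eq M 0 ((i # [j..<l]) @ [l, i] @ [Suc i..<Suc m])
        (([j..<l] @ [i]) @ [l, i] @ [Suc i..<Suc m])"
      using iM r1 r2 lM l by (intro idc_eq_append idc_eq_commute_word) auto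
    moreover have "idc_eq M 0 ([j..<l] @ [i, l, i] @ [Suc i..<Suc m])
        ([j..<l] @ [l, i, l] @ [Suc i..<Suc m])"
      using iM lM r1 r2 l by (intro idc_eq_context idc_eq_braid) auto
    moreover have "idc_eq M 0 (([j..<l] @ [l, i]) @ (l # [Suc i..<Suc m]))
        (([j..<l] @ [l, i]) @ ([Suc i..<Suc m] @ [l]))"
      using iM lM r1 r2 l by (intro idc_eq_prepend idc_eq_commute_word) auto
    ultimately have "idc_eq M 0 (i # [j..<Suc m]) ([j..<Suc m] @ [l])"
      unfolding eq by (auto intro: idc_eq_trans0)
    then show ?thesis using l b(2) by (intro move) auto
  qed
qed simp

lemma word_normal_word:
  assumes "set a \<subseteq> {1..<m}"
  shows "\<exists>c b. b \<in> normal_words m \<and> idc_eq m c a b"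
  using assms
proof (induction a)
  case Nil
  then show ?case using Nil_normal_word idc_eq_refl by blast
next
  case (Cons i a)
  then obtain c b where b: "b \<in> normal_words m" "idc_eq m c a b" by auto
  obtain d b' where b': "b' \<in> normal_words m" "idc_eq m d (i # b) b'"
    using letter_normal_word[of m m i b] b Cons.prems by auto
  have "idc_eq m (c + d) (i # a) b'"
    using idc_eq_trans[OF idc_eq_Cons[OF b(2)] b'(2)] Cons.prems by auto
  then show ?case using b' by blast
qed

lemma word_perm_inv_append: "word_perm_inv (a @ b) = word_perm_inv b \<circ> word_perm_inv a"
  by (induction a) (simp_all add: word_perm_inv_simps o_assoc)

text \<open>Prepending the letters of a run one after the other pulls the maximal value \<open>Suc m\<close> down from
  position \<open>Suc m\<close> to position \<open>j\<close>; since it is maximal, each step is an ascent.\<close>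

lemma run_word:
  assumes b: "demazure_inv b permutes {1..m}" "demazure_inv b = word_perm_inv b" "inversions M (demazure_inv b) = length b"
    and "1 \<le> j" "j \<le> Suc m" "Suc m \<le> M"
  defines "a \<equiv> [j..<Suc m] @ b"
  shows "demazure_inv a permutes {1..Suc m}" "demazure_inv a = word_perm_inv a" "inversions M (demazure_inv a) = length a"
    "demazure_inv a j = Suc m"
proof -
  let ?P = "\<lambda>a i. demazure_inv a permutes {1..Suc m} \<and> demazure_inv a = word_perm_inv a \<and> inversions M (demazure_inv a) = length a \<and>
    demazure_inv a i = Suc m"
  have "1 \<le> j \<longrightarrow> ?P ([j..<Suc m] @ b) j"
    using \<open>j \<le> Suc m\<close>
  proof (induction rule: inc_induct)
    case base
    have "demazure_inv b permutes {1..Suc m}" by (rule permutes_subset[OF b(1)]) auto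
    then show ?case using b permutes_not_in[OF b(1), of "Suc m"] by simp
  next
    case (step i)
    show ?case
    proof
      assume i: "1 \<le> i"
      let ?a = "[Suc i..<Suc m] @ b"
      have "?P ?a (Suc i)" by (rule mp[OF step.IH]) simp
      then have IH: "demazure_inv ?a permutes {1..Suc m}" "demazure_inv ?a = word_perm_inv ?a"
        "inversions M (demazure_inv ?a) = length ?a" "demazure_inv ?a (Suc i) = Suc m" by blast+
      have eq: "[i..<Suc m] @ b = i # ?a" using step by (simp add: upt_conv_Cons)
      have iM: "i \<in> {1..<Suc m}" "i \<in> {1..<M}" using i step assms(6) by auto
      have "demazure_inv ?a i \<in> {1..Suc m}" using IH(1) iM permutes_in_image[of "demazure_inv ?a" "{1..Suc m}" i] by auto
      moreover have "demazure_inv ?a i \<noteq> demazure_inv ?a (Suc i)"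
        using permutes_inj[OF IH(1)] by (metis injD n_not_Suc_n)
      ultimately have asc: "demazure_inv ?a i < demazure_inv ?a (Suc i)" using IH(4) by auto
      have "demazure_inv (i # ?a) = word_perm_inv (i # ?a)"
        using asc IH(2) by (simp add: bubble_def word_perm_inv_simps)
      moreover have "inversions M (demazure_inv (i # ?a)) = length (i # ?a)"
        using inversions_ascent[OF iM(2) asc] asc IH(3) by (simp add: bubble_def)
      moreover have "demazure_inv (i # ?a) permutes {1..Suc m}"
        using bubble_permutes[OF IH(1) iM(1)] by simp
      moreover have "demazure_inv (i # ?a) i = Suc m"
        using asc IH(4) by (simp add: bubble_def)
      ultimately show "?P ([i..<Suc m] @ b) i" unfolding eq by blast
    qed
  qed
  then have "?P a j" unfolding a_def using assms(4) by (rule mp)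
  then show "demazure_inv a permutes {1..Suc m}" "demazure_inv a = word_perm_inv a" "inversions M (demazure_inv a) = length a"
    "demazure_inv a j = Suc m" by blast+
qed

lemma normal_word_reduced:
  assumes "b \<in> normal_words m"
  shows "demazure_inv b permutes {1..m}" "demazure_inv b = word_perm_inv b" "m \<le> M \<Longrightarrow> inversions M (demazure_inv b) = length b"
proof -
  have "demazure_inv b permutes {1..m} \<and> demazure_inv b = word_perm_inv b \<and> inversions M (demazure_inv b) = length b"
    if "m \<le> M" for M
    using assms that
  proof (induction m arbitrary: b)
    case (Suc m)
    obtain j b' where b: "b = [j..<Suc m] @ b'" "1 \<le> j" "j \<le> Suc m" "b' \<in> normal_words m"
      using Suc.prems(1) by (rule normal_wordsE)
    have "demazure_inv b' permutes {1..m}" "demazure_inv b' = word_perm_inv b'" "inversions M (demazure_inv b') = length b'"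
      using Suc.IH[of b'] b(4) Suc.prems by auto
    from run_word[OF this b(2,3) Suc.prems(2)] show ?case unfolding b(1) by blast
  qed (simp add: word_perm_inv_simps)
  then show "demazure_inv b permutes {1..m}" "demazure_inv b = word_perm_inv b" "m \<le> M \<Longrightarrow> inversions M (demazure_inv b) = length b"
    by blast+
qed

text \<open>The position of the largest value determines the run, which can then be cancelled.\<close>

lemma normal_word_unique:
  assumes "a \<in> normal_words m" "b \<in> normal_words m" "demazure_inv a = demazure_inv b"
  shows "a = b"
  using assms
proof (induction m arbitrary: a b)
  case (Suc m)
  have top: "demazure_inv ([j..<Suc m] @ c) j = Suc m" if "1 \<le> j" "j \<le> Suc m" "c \<in> normal_words m" for j c
    using run_word(4)[OF normal_word_reduced(1,2)[OF that(3)]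
        normal_word_reduced(3)[OF that(3), of "Suc m"] that(1,2)] by simp
  obtain j a' where a: "a = [j..<Suc m] @ a'" "1 \<le> j" "j \<le> Suc m" "a' \<in> normal_words m"
    using Suc.prems(1) by (rule normal_wordsE)
  obtain i b' where b: "b = [i..<Suc m] @ b'" "1 \<le> i" "i \<le> Suc m" "b' \<in> normal_words m"
    using Suc.prems(2) by (rule normal_wordsE)
  have "demazure_inv a j = Suc m" "demazure_inv b i = Suc m"
    using top[OF a(2-4)] top[OF b(2-4)] a(1) b(1) by simp_all
  moreover have "inj (demazure_inv a)"
    using normal_word_reduced(1)[OF Suc.prems(1)] permutes_inj by blast
  ultimately have ij: "i = j" using Suc.prems(3) by (metis injD)
  let ?r = "[j..<Suc m]"
  have "word_perm_inv a = word_perm_inv b"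
    using normal_word_reduced(2)[OF Suc.prems(1)] normal_word_reduced(2)[OF Suc.prems(2)] Suc.prems(3)
    by simp
  then have eq: "word_perm_inv a' \<circ> word_perm_inv ?r = word_perm_inv b' \<circ> word_perm_inv ?r"
    unfolding a(1) b(1) ij word_perm_inv_append .
  have "set ?r \<subseteq> {1..<Suc m}" using a(2) by auto
  then have r: "word_perm_inv ?r permutes {1..Suc m}" by (rule word_perm_inv_permutes)
  have "word_perm_inv a' = (word_perm_inv a' \<circ> word_perm_inv ?r) \<circ> perm_inv (word_perm_inv ?r)"
    by (simp add: o_assoc[symmetric] permutes_inv_o(1)[OF r])
  also have "\<dots> = word_perm_inv b'"
    unfolding eq by (simp add: o_assoc[symmetric] permutes_inv_o(1)[OF r])
  finally have "demazure_inv a' = demazure_inv b'"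
    using normal_word_reduced(2)[OF a(4)] normal_word_reduced(2)[OF b(4)] by simp
  then show ?case using Suc.IH[OF a(4) b(4)] a(1) b(1) ij by simp
qed simp

lemma normal_word_exists:
  assumes "u permutes {1..m}"
  shows "\<exists>b\<in>normal_words m. demazure_inv b = u"
  using assms
proof (induction m arbitrary: u)
  case 0
  then show ?case by simp
next
  case (Suc m)
  define j where "j = perm_inv u (Suc m)"
  have uj: "u j = Suc m" using Suc.prems by (simp add: j_def permutes_inverses)
  then have j: "1 \<le> j" "j \<le> Suc m"
    using permutes_in_image[OF Suc.prems, of j] by auto
  let ?r = "[j..<Suc m]"
  have r: "word_perm_inv ?r permutes {1..Suc m}" using j by (intro word_perm_inv_permutes) auto
  have "demazure_inv [] permutes {1..m}" "demazure_inv [] = word_perm_inv []" "inversions (Suc m) (demazure_inv []) = length ([] :: nat list)"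
    by (simp_all add: word_perm_inv_simps permutes_id)
  from run_word(2,4)[OF this j] have rj: "word_perm_inv ?r j = Suc m" by simp
  define u' where "u' = u \<circ> perm_inv (word_perm_inv ?r)"
  have "u' permutes {1..Suc m}"
    unfolding u'_def by (intro permutes_compose permutes_inv r Suc.prems)
  moreover have "u' (Suc m) = Suc m"
    using rj uj permutes_inverses(2)[OF r, of j] by (simp add: u'_def)
  moreover have "x = Suc m" if "x \<in> {1..Suc m} - {1..m}" for x
    using that by auto
  ultimately have "u' permutes {1..m}"
    using permutes_superset[of u' "{1..Suc m}" "{1..m}"] by blast
  then obtain b where b: "b \<in> normal_words m" "demazure_inv b = u'" using Suc.IH by blast
  have "demazure_inv (?r @ b) = word_perm_inv b \<circ> word_perm_inv ?r"
    using normal_word_reduced(2)[OF normal_wordsI[OF j b(1)]] word_perm_inv_append[of ?r b] by simp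
  also have "\<dots> = u \<circ> (perm_inv (word_perm_inv ?r) \<circ> word_perm_inv ?r)"
    using normal_word_reduced(2)[OF b(1)] b(2) by (simp add: u'_def o_assoc)
  also have "\<dots> = u" using permutes_inv_o(2)[OF r] by simp
  finally show ?case using normal_wordsI[OF j b(1)] by blast
qed

section \<open>The basis of IdC and the Grothendieck polynomials\<close>

lemma beta_nonzero: "beta \<noteq> 0"
  unfolding beta_def by (metis lookup_single_eq lookup_zero pCons_eq_0_iff zero_neq_one)

lemma idc_eq_hecke_coeff:
  assumes "idc_eq m c a b"
  shows "hecke_coeff m u a = beta ^ c * hecke_coeff m u b"
  using lin_ext_hecke_coeff_ideal[OF assms[unfolded idc_eq_def], of u]
  by (simp add: lin_ext_diff lin_ext_scal)

text \<open>The functionals detect the normal word to which a word can be rewritten, and also the power of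
  beta that arises: this replaces the uniqueness of reduced words up to braid moves.\<close>

lemma idc_eq_normal_word:
  assumes "set a \<subseteq> {1..<m}" "b \<in> normal_words m" "demazure_inv b = demazure_inv a"
  shows "emon a - scal (hecke_coeff m (demazure_inv a) a) * emon b \<in> idc_ideal m"
proof -
  obtain c b' where b': "b' \<in> normal_words m" "idc_eq m c a b'"
    using word_normal_word[OF assms(1)] by blast
  have eq: "hecke_coeff m (demazure_inv b') a = beta ^ c"
    using idc_eq_hecke_coeff[OF b'(2), of "demazure_inv b'"] normal_word_reduced(3)[OF b'(1), of m]
    by (simp add: hecke_coeff_def)
  then have "demazure_inv a = demazure_inv b'"
    using beta_nonzero by (auto simp: hecke_coeff_def split: if_splits)
  then have "b' = b" using normal_word_unique[OF b'(1) assms(2)] assms(3) by simp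
  then show ?thesis using b'(2) eq assms(3) by (simp add: idc_eq_def)
qed

lemma e_perm_word:
  assumes "w permutes {1..m}"
  obtains a where "e_perm m w = emon a" "set a \<subseteq> {1..<m}" "demazure_inv a = perm_inv w"
    "length a = inversions m (perm_inv w)"
proof -
  have pi: "perm_inv w permutes {1..m}" by (rule permutes_inv[OF assms])
  obtain b where b: "b \<in> normal_words m" "demazure_inv b = perm_inv w"
    using normal_word_exists[OF pi] by blast
  have bw: "word_for m w b"
    using b normal_word_reduced(2)[OF b(1)] normal_words_letters[OF b(1)]
    by (simp add: word_for_iff_word_perm_inv[OF assms])
  obtain a' where "word_for m w a'" "\<forall>b. word_for m w b \<longrightarrow> length a' \<le> length b"
    using ex_has_least_nat[of "word_for m w" b length] bw by blast
  then have "\<exists>a. reduced_word m w a" by (auto simp: reduced_word_def)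
  then have red: "reduced_word m w (SOME a. reduced_word m w a)" by (rule someI_ex)
  define a where "a = (SOME a. reduced_word m w a)"
  have a: "set a \<subseteq> {1..<m}" "word_perm_inv a = perm_inv w" "length a \<le> length b"
    using red bw by (auto simp: reduced_word_def word_for_iff_word_perm_inv[OF assms] a_def)
  then have le: "length a \<le> inversions m (word_perm_inv a)"
    using normal_word_reduced(3)[OF b(1), of m] b(2) by simp
  then have "demazure_inv a = perm_inv w" using demazure_inv_eq_word_perm_inv[OF a(1)] a(2) by simp
  moreover have "length a = inversions m (perm_inv w)"
    using le inversions_word_perm_inv_le[OF a(1)] a(2) by simp
  ultimately show ?thesis using that a(1) by (simp add: e_perm_def a_def)
qed

lemma lin_ext_hecke_coeff_e_perm:
  assumes "w permutes {1..m}" "v permutes {1..m}"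
  shows "lin_ext (hecke_coeff m (perm_inv v)) (e_perm m w) = (if v = w then 1 else 0)"
proof -
  have "perm_inv w = perm_inv v \<longleftrightarrow> v = w"
    using permutes_bij[OF assms(1)] permutes_bij[OF assms(2)] by (metis inv_inv_eq)
  moreover obtain a where "e_perm m w = emon a" "demazure_inv a = perm_inv w" "length a = inversions m (perm_inv w)"
    using e_perm_word[OF assms(1)] by metis
  ultimately show ?thesis by (auto simp: hecke_coeff_def)
qed

lemma e_perm_carrier:
  assumes "w permutes {1..m}"
  shows "e_perm m w \<in> carrier (free_alg m)"
  using e_perm_word[OF assms] carrier_emon by metis

lemma idc_word_e_perm:
  assumes "set a \<subseteq> {1..<m}"
  shows "emon a - scal (hecke_coeff m (demazure_inv a) a) * e_perm m (perm_inv (demazure_inv a)) \<in> idc_ideal m"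
proof -
  have u: "demazure_inv a permutes {1..m}" by (rule demazure_inv_permutes[OF assms])
  have ii: "perm_inv (perm_inv (demazure_inv a)) = demazure_inv a" using permutes_bij[OF u] by (rule inv_inv_eq)
  obtain b where b: "b \<in> normal_words m" "demazure_inv b = demazure_inv a"
    using normal_word_exists[OF u] by blast
  obtain r where r: "e_perm m (perm_inv (demazure_inv a)) = emon r" "set r \<subseteq> {1..<m}" "demazure_inv r = demazure_inv a"
    "length r = inversions m (demazure_inv a)"
    using e_perm_word[OF permutes_inv[OF u]] unfolding ii by blast
  have "hecke_coeff m (demazure_inv a) r = 1" using r by (simp add: hecke_coeff_def)
  then have "emon r - emon b \<in> idc_ideal m"
    using idc_eq_normal_word[of r m b] r b by simp
  then have "scal (hecke_coeff m (demazure_inv a) a) * - (emon r - emon b) \<in> idc_ideal m"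
    by (intro idc_ideal_lmult idc_ideal_uminus carrier_scal)
  moreover have "emon a - scal (hecke_coeff m (demazure_inv a) a) * emon b \<in> idc_ideal m"
    by (rule idc_eq_normal_word[OF assms b])
  ultimately have "emon a - scal (hecke_coeff m (demazure_inv a) a) * emon b +
      scal (hecke_coeff m (demazure_inv a) a) * - (emon r - emon b) \<in> idc_ideal m"
    by (rule idc_ideal_add[rotated])
  then show ?thesis by (simp add: r(1) algebra_simps)
qed

text \<open>Spanning, with explicit coefficients.\<close>

lemma idc_expand:
  assumes "p \<in> carrier (free_alg m)"
  shows "p - (\<Sum>w | w permutes {1..m}. scal (lin_ext (hecke_coeff m (perm_inv w)) p) * e_perm m w)
    \<in> idc_ideal m"
proof -
  let ?K = "Poly_Mapping.keys p" and ?l = "Poly_Mapping.lookup p"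
  let ?P = "{w. w permutes {1..m}}"
  have fin: "finite ?P" by (rule finite_permutations) simp
  have word: "(\<Sum>w\<in>?P. scal (hecke_coeff m (perm_inv w) a) * e_perm m w) =
      scal (hecke_coeff m (demazure_inv a) a) * e_perm m (perm_inv (demazure_inv a))"
    if a: "set a \<subseteq> {1..<m}" for a
  proof -
    have u: "demazure_inv a permutes {1..m}" by (rule demazure_inv_permutes[OF a])
    have ii: "perm_inv (perm_inv (demazure_inv a)) = demazure_inv a" using permutes_bij[OF u] by (rule inv_inv_eq)
    have "hecke_coeff m (perm_inv w) a = 0" if "w permutes {1..m}" "w \<noteq> perm_inv (demazure_inv a)" for w
      using that permutes_bij[OF that(1)] by (auto simp: hecke_coeff_def inv_inv_eq)
    then have "(\<Sum>w\<in>?P. scal (hecke_coeff m (perm_inv w) a) * e_perm m w) =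
        (\<Sum>w\<in>{perm_inv (demazure_inv a)}. scal (hecke_coeff m (perm_inv w) a) * e_perm m w)"
      using fin permutes_inv[OF u] by (intro sum.mono_neutral_right) auto
    then show ?thesis by (simp add: ii)
  qed
  have "(\<Sum>w\<in>?P. scal (lin_ext (hecke_coeff m (perm_inv w)) p) * e_perm m w) =
      (\<Sum>w\<in>?P. \<Sum>u\<in>?K. scal (?l u) * (scal (hecke_coeff m (perm_inv w) (letters u)) * e_perm m w))"
    by (simp add: lin_ext_def scal_sum sum_distrib_right scal_mult mult.assoc)
  also have "\<dots> = (\<Sum>u\<in>?K. scal (?l u) *
      (\<Sum>w\<in>?P. scal (hecke_coeff m (perm_inv w) (letters u)) * e_perm m w))"
    by (subst sum.swap) (simp add: sum_distrib_left)
  also have "\<dots> = (\<Sum>u\<in>?K. scal (?l u) * (scal (hecke_coeff m (demazure_inv (letters u)) (letters u)) *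
      e_perm m (perm_inv (demazure_inv (letters u)))))"
    using assms by (intro sum.cong refl) (simp add: word carrier_free_alg_iff)
  finally have "p - (\<Sum>w\<in>?P. scal (lin_ext (hecke_coeff m (perm_inv w)) p) * e_perm m w) =
      (\<Sum>u\<in>?K. scal (?l u) * (emon (letters u) -
         scal (hecke_coeff m (demazure_inv (letters u)) (letters u)) * e_perm m (perm_inv (demazure_inv (letters u)))))"
    by (subst ealg_expand[of p]) (simp add: sum_subtractf right_diff_distrib)
  also have "\<dots> \<in> idc_ideal m"
    using assms by (intro idc_ideal_sum idc_ideal_lmult idc_word_e_perm carrier_scal)
      (simp add: carrier_free_alg_iff)
  finally show ?thesis .
qed

text \<open>Existence of the defining expansion is \<open>idc_expand\<close>. Applying the functionals to any expansion
  gives back its coefficients, which is uniqueness.\<close>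

lemma grothendieck_eq_lin_ext:
  assumes "w permutes {1..m}"
  shows "grothendieck m w = lin_ext (hecke_coeff m (perm_inv w))
    (prod_list (map (\<lambda>i. A_fac m i (var i)) [1..<m]))"
proof -
  define p where "p = prod_list (map (\<lambda>i. A_fac m i (var i)) [1..<m])"
  have p: "p \<in> carrier (free_alg m)"
    unfolding p_def A_fac_def h_fac_def egen_def
    by (intro carrier_prod_list) (auto intro!: carrier_prod_list carrier_intros)
  define G where "G w = (if w permutes {1..m} then lin_ext (hecke_coeff m (perm_inv w)) p else 0)" for w
  have carr: "(\<Sum>w | w permutes {1..m}. scal (H w) * e_perm m w) \<in> carrier (free_alg m)" for H
    by (intro carrier_sum carrier_mult carrier_scal e_perm_carrier) simp
  have fin: "finite {w. w permutes {1..m}}" by (rule finite_permutations) simp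
  have "grothendieck m = G"
    unfolding grothendieck_def p_def[symmetric]
  proof (rule the_equality)
    show "(\<forall>w. \<not> w permutes {1..m} \<longrightarrow> G w = 0) \<and> idc_class m p =
        idc_class m (\<Sum>w | w permutes {1..m}. scal (G w) * e_perm m w)"
      using idc_expand[OF p] by (simp add: idc_class_eq_iff[OF p carr] G_def)
  next
    fix H
    assume H: "(\<forall>w. \<not> w permutes {1..m} \<longrightarrow> H w = 0) \<and> idc_class m p =
        idc_class m (\<Sum>w | w permutes {1..m}. scal (H w) * e_perm m w)"
    then have "p - (\<Sum>w | w permutes {1..m}. scal (H w) * e_perm m w) \<in> idc_ideal m"
      by (simp add: idc_class_eq_iff[OF p carr])
    from lin_ext_hecke_coeff_ideal[OF this]
    have eq: "lin_ext (hecke_coeff m u) p =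
        (\<Sum>w | w permutes {1..m}. H w * lin_ext (hecke_coeff m u) (e_perm m w))" for u
      by (simp add: lin_ext_diff lin_ext_sum lin_ext_scal)
    show "H = G"
    proof
      fix v
      show "H v = G v"
      proof (cases "v permutes {1..m}")
        case True
        have "G v = (\<Sum>w | w permutes {1..m}. if v = w then H w else 0)"
          using True by (simp add: G_def eq) (intro sum.cong refl, simp add: lin_ext_hecke_coeff_e_perm)
        then show ?thesis using True fin by simp
      qed (use H in \<open>simp add: G_def\<close>)
    qed
  qed
  then show ?thesis using assms by (simp add: G_def p_def)
qed

section \<open>Expansion over sets of cells\<close>

text \<open>Letter \<open>l\<close> in the factor \<open>A\<^sub>i\<close> is the cell \<open>(i, l)\<close>; the letters of a row decrease.\<close>

definition row :: "nat \<Rightarrow> nat \<Rightarrow> (nat \<times> nat) list"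
  where "row n i = map (Pair i) (rev [i..<Suc n])"

definition positions :: "nat \<Rightarrow> (nat \<times> nat) list"
  where "positions n = concat (map (row n) [1..<Suc n])"

definition subword :: "(nat \<times> nat) set \<Rightarrow> (nat \<times> nat) list \<Rightarrow> nat list"
  where "subword T xs = map snd (filter (\<lambda>x. x \<in> T) xs)"

lemma set_row: "set (row n i) = {(i, l) | l. i \<le> l \<and> l \<le> n}"
  by (auto simp: row_def)

lemma set_positions: "set (positions n) = {(i, l). 1 \<le> i \<and> i \<le> l \<and> l \<le> n}"
  by (auto simp: positions_def set_row)

lemma distinct_positions: "distinct (positions n)"
proof -
  have "distinct (concat (map (row n) is))" if "distinct is" for "is"
    using that by (induction "is") (auto simp: set_row row_def distinct_map inj_on_def)
  then show ?thesis by (simp add: positions_def)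
qed

lemma subword_append: "subword T (xs @ ys) = subword T xs @ subword T ys"
  by (simp add: subword_def)

lemma subword_letters: "set (subword T xs) \<subseteq> snd ` set xs"
  by (auto simp: subword_def)

lemma length_subword:
  assumes "distinct xs" "T \<subseteq> set xs"
  shows "length (subword T xs) = card T"
proof -
  have "set (filter (\<lambda>x. x \<in> T) xs) = T" using assms(2) by auto
  then show ?thesis
    using distinct_card[OF distinct_filter[OF assms(1)], of "\<lambda>x. x \<in> T"] by (simp add: subword_def)
qed

lemma prod_h_fac_expand:
  assumes "distinct xs"
  shows "prod_list (map (\<lambda>x. h_fac (snd x) (var (fst x))) xs) =
    (\<Sum>T\<in>Pow (set xs). scal (\<Prod>x\<in>T. var (fst x)) * emon (subword T xs))"
  using assms
proof (induction xs)
  case Nil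
  then show ?case by (simp add: subword_def)
next
  case (Cons x xs)
  let ?g = "\<lambda>T xs. scal (\<Prod>x\<in>T. var (fst x)) * emon (subword T xs)"
  have x: "x \<notin> set xs" using Cons.prems by simp
  have skip: "?g T (x # xs) = ?g T xs" if "T \<subseteq> set xs" for T
    using x that by (auto simp: subword_def)
  have take: "?g (insert x T) (x # xs) = scal (var (fst x)) * egen (snd x) * ?g T xs"
    if T: "T \<subseteq> set xs" for T
  proof -
    have "filter (\<lambda>y. y \<in> insert x T) xs = filter (\<lambda>y. y \<in> T) xs"
      using x by (intro filter_cong) auto
    then have "subword (insert x T) (x # xs) = snd x # subword T xs"
      by (simp add: subword_def)
    moreover have "(\<Prod>y\<in>insert x T. var (fst y)) = var (fst x) * (\<Prod>y\<in>T. var (fst y))"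
      using x T finite_subset[OF T] by (intro prod.insert) auto
    moreover have "emon (snd x # subword T xs) = egen (snd x) * emon (subword T xs)"
      by (simp add: egen_def flip: emon_append)
    moreover have "scal c * (egen l * e) = egen l * (scal c * e)" for c l e
      by (simp only: mult.assoc[symmetric] scal_commute[of "egen l" c])
    ultimately show ?thesis
      by (simp only: scal_mult mult.assoc)
  qed
  have "inj_on (insert x) (Pow (set xs))" using x by (intro inj_onI) (metis PowD insert_ident subsetD)
  then have "(\<Sum>T\<in>insert x ` Pow (set xs). ?g T (x # xs)) =
      (\<Sum>T\<in>Pow (set xs). scal (var (fst x)) * egen (snd x) * ?g T xs)"
    by (simp add: sum.reindex take)
  moreover have "(\<Sum>T\<in>Pow (set xs). ?g T (x # xs)) = (\<Sum>T\<in>Pow (set xs). ?g T xs)"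
    by (intro sum.cong refl skip) simp
  moreover have "Pow (set (x # xs)) = Pow (set xs) \<union> insert x ` Pow (set xs)"
    by (simp add: Pow_insert)
  moreover have "Pow (set xs) \<inter> insert x ` Pow (set xs) = {}" using x by auto
  ultimately have "(\<Sum>T\<in>Pow (set (x # xs)). ?g T (x # xs)) =
      (1 + scal (var (fst x)) * egen (snd x)) * (\<Sum>T\<in>Pow (set xs). ?g T xs)"
    by (simp add: sum.union_disjoint distrib_right sum_distrib_left sum.distrib)
  then show ?case using Cons by (simp add: h_fac_def)
qed

lemma prod_A_fac:
  "prod_list (map (\<lambda>i. A_fac (Suc n) i (var i)) [1..<Suc n]) =
   prod_list (map (\<lambda>x. h_fac (snd x) (var (fst x))) (positions n))"
proof -
  have "prod_list (map (\<lambda>i. A_fac (Suc n) i (var i)) is) =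
    prod_list (map (\<lambda>x. h_fac (snd x) (var (fst x))) (concat (map (row n) is)))" for "is"
    by (induction "is") (simp_all add: A_fac_def row_def comp_def)
  then show ?thesis by (simp add: positions_def)
qed

lemma grothendieck_eq_sum:
  assumes "w permutes {1..Suc n}"
  shows "grothendieck (Suc n) w =
    (\<Sum>T | T \<subseteq> set (positions n) \<and> demazure_inv (subword T (positions n)) = perm_inv w.
       beta ^ (card T - inversions (Suc n) (perm_inv w)) * (\<Prod>x\<in>T. var (fst x)))"
proof -
  have "grothendieck (Suc n) w = (\<Sum>T\<in>Pow (set (positions n)).
      (\<Prod>x\<in>T. var (fst x)) * hecke_coeff (Suc n) (perm_inv w) (subword T (positions n)))"
    by (simp add: grothendieck_eq_lin_ext[OF assms] prod_A_fac prod_h_fac_expand[OF distinct_positions]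
        lin_ext_sum lin_ext_scal)
  also have "\<dots> = (\<Sum>T\<in>Pow (set (positions n)).
      if demazure_inv (subword T (positions n)) = perm_inv w
      then beta ^ (card T - inversions (Suc n) (perm_inv w)) * (\<Prod>x\<in>T. var (fst x)) else 0)"
    by (intro sum.cong refl) (simp add: hecke_coeff_def length_subword[OF distinct_positions])
  also have "\<dots> = (\<Sum>T\<in>{T \<in> Pow (set (positions n)). demazure_inv (subword T (positions n)) = perm_inv w}.
      beta ^ (card T - inversions (Suc n) (perm_inv w)) * (\<Prod>x\<in>T. var (fst x)))"
    by (rule sum.inter_filter[symmetric]) simp
  finally show ?thesis by (simp only: Pow_iff)
qed

section \<open>Evaluation of polynomials\<close>

lemma poly_of_int_add:
  fixes b :: "'a::comm_ring_1"
  shows "poly (map_poly of_int (p + q)) b = poly (map_poly of_int p) b + poly (map_poly of_int q) b"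
  by (induction p q rule: poly_induct2) (simp_all add: map_poly_pCons algebra_simps)

lemma poly_of_int_X_power:
  fixes b :: "'a::comm_ring_1"
  shows "poly (map_poly of_int ([:0, 1:] ^ e)) b = b ^ e"
  by (induction e) (simp_all add: map_poly_pCons)

lemma subst_bx_superset:
  assumes "finite S" "Poly_Mapping.keys p \<subseteq> S"
  shows "subst_bx b x p = (\<Sum>\<mu>\<in>S. poly (map_poly of_int (Poly_Mapping.lookup p \<mu>)) b *
     (\<Prod>i\<in>Poly_Mapping.keys \<mu>. x i ^ Poly_Mapping.lookup \<mu> i))"
  unfolding subst_bx_def using assms
  by (intro sum.mono_neutral_left) (auto simp: in_keys_iff)

lemma subst_bx_add: "subst_bx b x (p + q) = subst_bx b x p + subst_bx b x q"
proof -
  let ?S = "Poly_Mapping.keys p \<union> Poly_Mapping.keys q"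
  have "Poly_Mapping.keys (p + q) \<subseteq> ?S" by (rule Poly_Mapping.keys_add)
  then show ?thesis
    by (simp add: subst_bx_superset[of ?S] lookup_add poly_of_int_add distrib_right sum.distrib)
qed

lemma subst_bx_sum: "subst_bx b x (\<Sum>a\<in>A. f a) = (\<Sum>a\<in>A. subst_bx b x (f a))"
  by (induction A rule: infinite_finite_induct) (simp_all add: subst_bx_add, simp_all add: subst_bx_def)

lemma monomial_eval_add:
  fixes x :: "nat \<Rightarrow> 'a::comm_ring_1"
  defines "ev \<equiv> \<lambda>\<mu>. \<Prod>i\<in>Poly_Mapping.keys \<mu>. x i ^ Poly_Mapping.lookup \<mu> i"
  shows "ev (\<mu> + \<nu>) = ev \<mu> * ev \<nu>"
proof -
  have super: "ev \<rho> = (\<Prod>i\<in>S. x i ^ Poly_Mapping.lookup \<rho> i)"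
    if "finite S" "Poly_Mapping.keys \<rho> \<subseteq> S" for S \<rho>
    unfolding ev_def using that by (intro prod.mono_neutral_left) (auto simp: in_keys_iff)
  let ?S = "Poly_Mapping.keys \<mu> \<union> Poly_Mapping.keys \<nu>"
  have "Poly_Mapping.keys (\<mu> + \<nu>) \<subseteq> ?S" by (rule Poly_Mapping.keys_add)
  then show ?thesis
    by (simp add: super[of ?S] lookup_add power_add prod.distrib)
qed

lemma monomial_as_single:
  assumes "finite T"
  shows "beta ^ e * (\<Prod>a\<in>T. var (f a)) =
    Poly_Mapping.single (\<Sum>a\<in>T. Poly_Mapping.single (f a) 1) ([:0, 1:] ^ e)"
proof -
  have "beta ^ e = Poly_Mapping.single 0 ([:0, 1:] ^ e)"
    by (induction e) (simp_all add: beta_def mult_single)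
  moreover have "(\<Prod>a\<in>T. var (f a)) = Poly_Mapping.single (\<Sum>a\<in>T. Poly_Mapping.single (f a) 1) 1"
    using assms by (induction T) (simp_all add: var_def mult_single)
  ultimately show ?thesis by (simp add: mult_single)
qed

lemma subst_bx_monomial:
  assumes "finite T"
  shows "subst_bx b x (beta ^ e * (\<Prod>a\<in>T. var (f a))) = b ^ e * (\<Prod>a\<in>T. x (f a))"
proof -
  let ?m = "\<Sum>a\<in>T. Poly_Mapping.single (f a) (1::nat)"
  have "(\<Prod>i\<in>Poly_Mapping.keys ?m. x i ^ Poly_Mapping.lookup ?m i) = (\<Prod>a\<in>T. x (f a))"
    using assms
  proof (induction T)
    case (insert a T)
    then show ?case by (simp add: monomial_eval_add)
  qed simp
  moreover have "[:0, 1::int:] ^ e \<noteq> 0" by simp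
  ultimately show ?thesis
    unfolding monomial_as_single[OF assms]
    by (simp add: subst_bx_def poly_of_int_X_power)
qed

section \<open>Rank numbers of Demazure products\<close>

definition rank_count :: "(nat \<Rightarrow> nat) \<Rightarrow> nat \<Rightarrow> nat \<Rightarrow> nat"
  where "rank_count u p q = (\<Sum>v = 1..q. of_bool (p < u v))"

lemma rank_count_0 [simp]: "rank_count u p 0 = 0"
  by (simp add: rank_count_def)

lemma rank_count_Suc:
  "rank_count u p (Suc q) = rank_count u p q + of_bool (p < u (Suc q))"
  by (simp add: rank_count_def atLeastAtMostSuc_conv One_nat_def)

lemma rank_count_card: "rank_count u p q = card {v \<in> {1..q}. p < u v}"
proof -
  have "{1..q} \<inter> {v. p < u v} = {v \<in> {1..q}. p < u v}" by auto
  then show ?thesis by (simp add: rank_count_def sum.If_cases of_bool_def)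
qed

lemma rank_count_mono: "q \<le> q' \<Longrightarrow> rank_count u p q \<le> rank_count u p q'"
  by (induction q' rule: dec_induct) (auto simp: rank_count_Suc)

text \<open>Sorting positions \<open>l\<close> and \<open>l + 1\<close> only affects the count at \<open>q = l\<close>, and there the sorted pair
  contributes one value above \<open>p\<close> as soon as one of the two values is above \<open>p\<close>.\<close>

lemma rank_count_bubble:
  assumes "1 \<le> l"
  shows "rank_count (bubble l u) p q =
    (if q = l then min (Suc (rank_count u p (l - 1))) (rank_count u p (Suc l))
     else rank_count u p q)"
proof -
  obtain m where l: "l = Suc m" using assms by (cases l) auto
  let ?b = "bubble l u"
  have b: "?b l = max (u l) (u (Suc l))" "?b (Suc l) = min (u l) (u (Suc l))"
    by (simp_all add: bubble_eq_max_min)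
  have low: "rank_count ?b p q = rank_count u p q" if "q < l" for q
    using that unfolding rank_count_def
    by (intro sum.cong refl) (auto simp: bubble_eq_max_min)
  have at: "rank_count ?b p l = min (Suc (rank_count u p m)) (rank_count u p (Suc l))"
    using low[of m] b by (simp add: l rank_count_Suc less_max_iff_disj)
  have high: "rank_count ?b p q = rank_count u p q" if "Suc l \<le> q" for q
    using that
  proof (induction q rule: dec_induct)
    case base
    show ?case
      using low[of m] b by (simp add: l rank_count_Suc less_max_iff_disj)
  next
    case (step q)
    then show ?case by (auto simp: rank_count_Suc bubble_eq_max_min)
  qed
  have "l - 1 = m" by (simp add: l)
  then show ?thesis using low[of q] high[of q] at by (cases q l rule: linorder_cases) simp_all
qed

text \<open>The maximal length of a chain of positions outside of \<open>T\<close>, within the last \<open>r\<close> of the rows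
  \<open>1, \<dots>, p\<close> and the first \<open>d\<close> of the lines \<open>l - i = 0, 1, \<dots>\<close>; see \<open>card_descending_le\<close> and
  \<open>descending_exists\<close>. The position that is tested is the corner of this region.\<close>

fun chain_len :: "(nat \<times> nat) set \<Rightarrow> nat \<Rightarrow> nat \<Rightarrow> nat \<Rightarrow> nat"
  where
    "chain_len T p 0 d = 0"
  | "chain_len T p (Suc r) 0 = 0"
  | "chain_len T p (Suc r) (Suc d) =
      (if (p - r, p - r + d) \<in> T
       then max (chain_len T p (Suc r) d) (chain_len T p r (Suc d))
       else Suc (chain_len T p r d))"

lemma chain_len_0 [simp]: "chain_len T p r 0 = 0"
  by (cases r) simp_all

lemma chain_len_le_right: "chain_len T p r d \<le> d"
  by (induction T p r d rule: chain_len.induct) auto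

lemma chain_len_le_rows: "chain_len T p r d \<le> r"
  by (induction T p r d rule: chain_len.induct) auto

lemma rank_count_id: "rank_count id p q = q - p"
  by (induction q) (auto simp: rank_count_Suc)

text \<open>The rows after row \<open>p\<close> have only letters above \<open>p\<close>, and do not yet mix the values up to \<open>p\<close>
  with the values above \<open>p\<close>.\<close>

lemma rank_count_demazure_inv_high:
  assumes "set a \<subseteq> {Suc p..}"
  shows "rank_count (demazure_inv a) p q = q - p"
  using assms
proof (induction a arbitrary: q)
  case (Cons l a)
  then show ?case by (auto simp: rank_count_bubble)
qed (simp add: rank_count_id[unfolded id_def] id_def)

lemma min_diff_step:
  fixes x d :: nat
  assumes "x \<le> d"
  shows "min (Suc (min c (d - x))) (min c (Suc d - y)) = min c (Suc d - max x y)"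
  using assms by (cases "x \<le> y") (auto simp: min_def max_def)

text \<open>Within a row the letters act in increasing order. When the turn of \<open>l\<close> comes, the count at
  \<open>l - 1\<close> already belongs to the new row and the count at \<open>l + 1\<close> still to the old one, so that the
  update of \<open>rank_count_bubble\<close> is the recursion of \<open>chain_len\<close>. The cap \<open>Suc n - p\<close> is the number of
  all values above \<open>p\<close>.\<close>

lemma rank_count_row:
  fixes T :: "(nat \<times> nat) set"
  assumes a: "1 \<le> a" "a + r = p" and p: "p \<le> n"
    and u: "\<And>d. a + d \<le> Suc n \<Longrightarrow> rank_count u p (a + d) = min (Suc n - p) (d - chain_len T p r d)"
  defines "v \<equiv> \<lambda>l. foldr bubble (filter (\<lambda>l. (a, l) \<in> T) (rev [a..<l])) u"
  shows "a - 1 + d \<le> Suc n \<Longrightarrow>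
    rank_count (v (Suc n)) p (a - 1 + d) = min (Suc n - p) (d - chain_len T p (Suc r) d)"
proof -
  let ?c = "Suc n - p"
  have inv: "(\<forall>d. a - 1 + d < l \<longrightarrow>
        rank_count (v l) p (a - 1 + d) = min ?c (d - chain_len T p (Suc r) d)) \<and>
      (\<forall>q\<ge>l. rank_count (v l) p q = rank_count u p q)"
    if "a \<le> l" "l \<le> Suc n" for l
    using that
  proof (induction l rule: dec_induct)
    case base
    have "rank_count u p a = 0" using u[of 0] base a p by simp
    then have z: "rank_count u p (a - 1) = 0"
      using rank_count_mono[of "a - 1" a u p] by simp
    have "rank_count u p (a - 1 + d) = min ?c (d - chain_len T p (Suc r) d)"
      if "a - 1 + d < a" for d
    proof -
      have "d = 0" using that a by simp
      then show ?thesis using z by simp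
    qed
    then show ?case by (simp add: v_def)
  next
    case (step l)
    then have IH: "\<And>d. a - 1 + d < l \<Longrightarrow>
        rank_count (v l) p (a - 1 + d) = min ?c (d - chain_len T p (Suc r) d)"
      "\<And>q. l \<le> q \<Longrightarrow> rank_count (v l) p q = rank_count u p q" by auto
    have vS: "v (Suc l) = (if (a, l) \<in> T then bubble l (v l) else v l)"
      using step by (simp add: v_def upt_Suc)
    have l: "1 \<le> l" using step a by simp
    have other: "rank_count (v (Suc l)) p q = rank_count (v l) p q" if "q \<noteq> l" for q
      using that l by (simp add: vS rank_count_bubble)
    define d where "d = l - a"
    have ld: "l = a + d" using step by (simp add: d_def)
    have "rank_count (v (Suc l)) p l = min ?c (Suc d - chain_len T p (Suc r) (Suc d))"
    proof (cases "(a, l) \<in> T")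
      case True
      have "rank_count (v l) p (l - 1) = min ?c (d - chain_len T p (Suc r) d)"
        using IH(1)[of d] ld a by (simp add: algebra_simps)
      moreover have "rank_count (v l) p (Suc l) = min ?c (Suc d - chain_len T p r (Suc d))"
        using IH(2)[of "Suc l"] u[of "Suc d"] ld step by simp
      moreover have "chain_len T p (Suc r) (Suc d) =
          max (chain_len T p (Suc r) d) (chain_len T p r (Suc d))"
        using True a ld by auto
      moreover have "rank_count (v (Suc l)) p l =
          min (Suc (rank_count (v l) p (l - 1))) (rank_count (v l) p (Suc l))"
        using True l by (simp add: vS rank_count_bubble)
      ultimately show ?thesis
        using min_diff_step[OF chain_len_le_right] by metis
    next
      case False
      have "rank_count (v l) p l = min ?c (d - chain_len T p r d)"
        using IH(2)[of l] u[of d] ld step by simp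
      moreover have "chain_len T p (Suc r) (Suc d) = Suc (chain_len T p r d)"
        using False a ld by auto
      ultimately show ?thesis using False by (simp add: vS del: chain_len.simps)
    qed
    moreover have "a - 1 + d' < l \<or> (a - 1 + d' = l \<and> d' = Suc d)" if "a - 1 + d' < Suc l" for d'
      using that ld a by auto
    ultimately show ?case
      using IH other by (metis Suc_le_eq less_irrefl nat_less_le)
  qed
  assume d: "a - 1 + d \<le> Suc n"
  show ?thesis
  proof (cases "a - 1 + d < Suc n")
    case True
    then show ?thesis using inv[of "Suc n"] a p by simp
  next
    case False
    then have eq: "a - 1 + d = Suc n" using d by simp
    have "rank_count (v (Suc n)) p (Suc n) = rank_count u p (Suc n)"
      using inv[of "Suc n"] a p by simp
    also have "\<dots> = min ?c (Suc n - a - chain_len T p r (Suc n - a))"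
      using u[of "Suc n - a"] a p by simp
    also have "\<dots> = ?c"
      using chain_len_le_rows[of T p r "Suc n - a"] a p by simp
    also have "\<dots> = min ?c (d - chain_len T p (Suc r) d)"
      using chain_len_le_rows[of T p "Suc r" d] eq a p by (simp del: chain_len.simps)
    finally show ?thesis by (simp add: eq)
  qed
qed

lemma subword_row: "subword T (row n i) = filter (\<lambda>l. (i, l) \<in> T) (rev [i..<Suc n])"
  by (simp add: subword_def row_def filter_map comp_def)

text \<open>The word acts from its right end, so the rows enter in the order \<open>n, \<dots>, 1\<close>; the rows after row
  \<open>p\<close> give the initial state, and the induction adds row \<open>p - r\<close>.\<close>

lemma rank_count_demazure_inv_subword:
  assumes "p \<le> n" "q \<le> Suc n"
  shows "rank_count (demazure_inv (subword T (positions n))) p q = min (Suc n - p) (q - chain_len T p p q)"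
proof -
  define u where "u r = demazure_inv (subword T (concat (map (row n) [Suc p - r..<Suc n])))" for r
  have "rank_count (u r) p (p - r + d) = min (Suc n - p) (d - chain_len T p r d)"
    if "r \<le> p" "p - r + d \<le> Suc n" for r d
    using that
  proof (induction r arbitrary: d)
    case 0
    have "set (subword T (concat (map (row n) [Suc p..<Suc n]))) \<subseteq> {Suc p..}"
      using subword_letters[of T "concat (map (row n) [Suc p..<Suc n])"] by (fastforce simp: set_row)
    then show ?case using 0 by (simp add: u_def rank_count_demazure_inv_high)
  next
    case (Suc r)
    define a where "a = p - r"
    have a: "1 \<le> a" "a + r = p" using Suc.prems by (auto simp: a_def)
    have "[Suc p - Suc r..<Suc n] = a # [Suc p - r..<Suc n]"
      using a assms(1) by (simp add: upt_conv_Cons a_def Suc_diff_le)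
    then have uS: "u (Suc r) = foldr bubble (filter (\<lambda>l. (a, l) \<in> T) (rev [a..<Suc n])) (u r)"
      by (simp add: u_def subword_append subword_row demazure_inv_append)
    have "a - 1 + d = p - Suc r + d" using a by simp
    moreover have "rank_count (u r) p (a + d) = min (Suc n - p) (d - chain_len T p r d)"
      if "a + d \<le> Suc n" for d
      using Suc.IH[of d] Suc.prems that by (simp add: a_def)
    ultimately show ?case
      using rank_count_row[OF a assms(1), of "u r" T d] Suc.prems unfolding uS by simp
  qed
  from this[of p q] assms show ?thesis by (simp add: u_def positions_def One_nat_def)
qed

section \<open>Chains of missing cells\<close>

text \<open>Cells are written here as \<open>(i, l - i)\<close>. Since \<open>N - (l - i)\<close> is the right end point of the
  associated diagonal, descending means that left and right end points increase together.\<close>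

definition descending :: "(nat \<times> nat) set \<Rightarrow> bool"
  where "descending S \<longleftrightarrow> (\<forall>x\<in>S. \<forall>y\<in>S. x \<noteq> y \<longrightarrow>
    (fst x < fst y \<and> snd y < snd x) \<or> (fst y < fst x \<and> snd x < snd y))"

definition gaps :: "(nat \<times> nat) set \<Rightarrow> nat \<Rightarrow> nat \<Rightarrow> nat \<Rightarrow> (nat \<times> nat) set"
  where "gaps T p r d = {(i, e). p - r < i \<and> i \<le> p \<and> e < d \<and> (i, i + e) \<notin> T}"

lemma finite_gaps: "finite (gaps T p r d)"
  by (rule finite_subset[of _ "{..p} \<times> {..d}"]) (auto simp: gaps_def)

lemma descending_subset: "descending S \<Longrightarrow> S' \<subseteq> S \<Longrightarrow> descending S'"
  unfolding descending_def by blast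

text \<open>The corner of the region is \<open>(p - r, d)\<close>. If it is not in \<open>T\<close>, at most one element of a chain lies
  on the two sides of the region that meet in it. If it is in \<open>T\<close>, a chain that meets the row
  \<open>p - r\<close> avoids the line \<open>l - i = d\<close>.\<close>

lemma card_descending_le:
  assumes "r \<le> p" "S \<subseteq> gaps T p r d" "descending S"
  shows "card S \<le> chain_len T p r d"
  using assms
proof (induction T p r d arbitrary: S rule: chain_len.induct)
  case (1 T p d)
  then have "S = {}" by (auto simp: gaps_def)
  then show ?case by simp
next
  case (2 T p r)
  then have "S = {}" by (auto simp: gaps_def)
  then show ?case by simp
next
  case (3 T p r d)
  have fin: "finite S" using 3(5) finite_gaps finite_subset by blast
  have in_S: "p - r \<le> fst x \<and> fst x \<le> p \<and> snd x \<le> d \<and> (fst x, fst x + snd x) \<notin> T" if "x \<in> S" for x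
    using that 3(4,5) by (auto simp: gaps_def)
  have desc: "(fst x < fst y \<and> snd y < snd x) \<or> (fst y < fst x \<and> snd x < snd y)"
    if "x \<in> S" "y \<in> S" "x \<noteq> y" for x y
    using 3(6) that unfolding descending_def by blast
  show ?case
  proof (cases "(p - r, p - r + d) \<in> T")
    case True
    show ?thesis
    proof (cases "\<exists>x\<in>S. fst x = p - r")
      case True
      then obtain x where x: "x \<in> S" "fst x = p - r" by blast
      have "snd y < d" if "y \<in> S" for y
      proof (cases "y = x")
        case True
        then have "snd x \<noteq> d" using in_S[OF x(1)] x \<open>(p - r, p - r + d) \<in> T\<close> by auto
        then show ?thesis using in_S[OF x(1)] True by auto
      next
        case False
        then show ?thesis using desc[OF x(1) that] in_S[OF that] in_S[OF x(1)] x by auto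
      qed
      then have "S \<subseteq> gaps T p (Suc r) d" using 3(5) by (auto simp: gaps_def)
      then show ?thesis using 3(1)[OF \<open>_ \<in> T\<close> 3(4) _ 3(6)] \<open>_ \<in> T\<close> by simp
    next
      case False
      then have "S \<subseteq> gaps T p r (Suc d)" using 3(4,5) in_S by (fastforce simp: gaps_def)
      then show ?thesis using 3(2)[OF \<open>_ \<in> T\<close> _ _ 3(6)] 3(4) \<open>_ \<in> T\<close> by simp
    qed
  next
    case False
    obtain S' where S': "S' \<subseteq> S" "card S \<le> Suc (card S')" "\<forall>y\<in>S'. fst y \<noteq> p - r \<and> snd y \<noteq> d"
    proof (cases "\<exists>x\<in>S. fst x = p - r \<or> snd x = d")
      case True
      then obtain x where x: "x \<in> S" "fst x = p - r \<or> snd x = d" by blast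
      have "fst y \<noteq> p - r \<and> snd y \<noteq> d" if "y \<in> S - {x}" for y
        using desc[of x y] that in_S[of y] in_S[of x] x by auto
      moreover have "card S \<le> Suc (card (S - {x}))"
        using card_Suc_Diff1[OF fin x(1)] by simp
      ultimately show ?thesis using that[of "S - {x}"] by blast
    next
      case False
      then show ?thesis using that[of S] by auto
    qed
    have "S' \<subseteq> gaps T p r d"
      using S'(1,3) in_S 3(4) by (fastforce simp: gaps_def)
    then have "card S' \<le> chain_len T p r d"
      using 3(3)[OF False _ _ descending_subset[OF 3(6) S'(1)]] 3(4) by simp
    then show ?thesis using S'(2) False by simp
  qed
qed

lemma descending_exists:
  assumes "r \<le> p"
  shows "\<exists>S. S \<subseteq> gaps T p r d \<and> descending S \<and> card S = chain_len T p r d"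
  using assms
proof (induction T p r d rule: chain_len.induct)
  case (3 T p r d)
  have sub1: "gaps T p (Suc r) d \<subseteq> gaps T p (Suc r) (Suc d)"
    and sub2: "gaps T p r (Suc d) \<subseteq> gaps T p (Suc r) (Suc d)"
    and sub3: "gaps T p r d \<subseteq> gaps T p (Suc r) (Suc d)"
    using 3(4) by (auto simp: gaps_def)
  show ?case
  proof (cases "(p - r, p - r + d) \<in> T")
    case True
    obtain S1 where S1: "S1 \<subseteq> gaps T p (Suc r) d" "descending S1" "card S1 = chain_len T p (Suc r) d"
      using 3(1)[OF True 3(4)] by blast
    obtain S2 where S2: "S2 \<subseteq> gaps T p r (Suc d)" "descending S2" "card S2 = chain_len T p r (Suc d)"
      using 3(2)[OF True] 3(4) by auto
    show ?thesis
    proof (cases "chain_len T p r (Suc d) \<le> chain_len T p (Suc r) d")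
      case le: True
      then show ?thesis using S1 sub1 True by (intro exI[of _ S1]) auto
    next
      case False
      then show ?thesis using S2 sub2 True by (intro exI[of _ S2]) auto
    qed
  next
    case False
    obtain S where S: "S \<subseteq> gaps T p r d" "descending S" "card S = chain_len T p r d"
      using 3(3)[OF False] 3(4) by auto
    let ?x = "(p - r, d)"
    have "?x \<notin> S" using S(1) by (auto simp: gaps_def)
    then have "card (insert ?x S) = Suc (card S)"
      using finite_subset[OF S(1) finite_gaps] by simp
    moreover have "?x \<in> gaps T p (Suc r) (Suc d)"
      using False 3(4) by (auto simp: gaps_def)
    moreover have "descending (insert ?x S)"
      using S(1,2) by (fastforce simp: descending_def gaps_def)
    ultimately show ?thesis
      using S sub3 False by (intro exI[of _ "insert ?x S"]) auto
  qed
qed (intro exI[of _ "{}"], simp add: descending_def)+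

section \<open>The permutation \<open>1\<^sup>k \<times> w\<^sub>0\<close>\<close>

lemma w_perm_involution: "w_perm k m (w_perm k m i) = i"
  by (auto simp: w_perm_def)

lemma w_perm_permutes: "w_perm k m permutes {1..m}"
  unfolding permutes_def
proof (intro conjI allI impI)
  show "w_perm k m x = x" if "x \<notin> {1..m}" for x
    using that by (auto simp: w_perm_def)
  show "\<exists>!x. w_perm k m x = y" for y
    using w_perm_involution by metis
qed

lemma inv_w_perm: "perm_inv (w_perm k m) = w_perm k m"
  by (rule inv_unique_comp) (auto simp: fun_eq_iff w_perm_involution)

lemma rank_count_w_perm:
  assumes "k \<le> p" "p \<le> m"
  shows "rank_count (w_perm k m) p (k + (m - p)) = m - p"
proof -
  have "{v \<in> {1..k + (m - p)}. p < w_perm k m v} = {k + 1..k + (m - p)}"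
    using assms by (auto simp: w_perm_def)
  then show ?thesis by (simp add: rank_count_card)
qed

text \<open>The rank conditions place the \<open>m - p\<close> values above \<open>p\<close> into the positions
  \<open>k + 1, \<dots>, k + (m - p)\<close>, for each \<open>p\<close>; comparing \<open>p - 1\<close> with \<open>p\<close> locates the value \<open>p\<close>.\<close>

lemma permutes_eq_w_perm:
  assumes u: "u permutes {1..m}" and "k \<le> m"
    and fixed: "\<And>v. v \<in> {1..k} \<Longrightarrow> u v = v"
    and rank: "\<And>p. k \<le> p \<Longrightarrow> p < m \<Longrightarrow> rank_count u p (k + (m - p)) = m - p"
  shows "u = w_perm k m"
proof
  have above: "v \<in> {k + 1..k + (m - p)} \<longleftrightarrow> p < u v" if p: "k \<le> p" "p < m" and v: "v \<in> {1..m}" for p v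
  proof -
    let ?A = "{v \<in> {1..m}. p < u v}"
    have "u ` ?A = {y \<in> u ` {1..m}. p < y}" by auto
    also have "\<dots> = {p + 1..m}" unfolding permutes_image[OF u] by auto
    finally have "card (u ` ?A) = m - p" by simp
    moreover have "inj_on u ?A" using permutes_inj[OF u] by (rule inj_on_subset) simp
    ultimately have cA: "card ?A = m - p" by (simp add: card_image)
    have sub: "{v \<in> {1..k + (m - p)}. p < u v} \<subseteq> ?A" using p by auto
    have "{v \<in> {1..k + (m - p)}. p < u v} = ?A"
      using rank[OF p] cA by (intro card_subset_eq sub) (simp_all add: rank_count_card)
    then have "?A \<subseteq> {k + 1..k + (m - p)}" using fixed p by fastforce
    then have "?A = {k + 1..k + (m - p)}" using cA by (intro card_subset_eq) simp_all
    then show ?thesis using v by blast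
  qed
  fix v
  consider "v \<notin> {1..m}" | "v \<in> {1..k}" | "v \<in> {k + 1..m}" by fastforce
  then show "u v = w_perm k m v"
  proof cases
    case 1
    then show ?thesis using permutes_not_in[OF u 1] by (auto simp: w_perm_def)
  next
    case 2
    then show ?thesis using fixed by (auto simp: w_perm_def)
  next
    case 3
    define p where "p = m + 1 - (v - k)"
    have p: "k + 1 \<le> p" "p \<le> m" "v = k + (m + 1 - p)" using 3 by (auto simp: p_def)
    have "p - 1 < u v" using above[of "p - 1" v] p 3 by auto
    moreover have "u v \<le> p"
    proof (cases "p = m")
      case True
      then show ?thesis using permutes_in_image[OF u, of v] 3 by auto
    next
      case False
      then show ?thesis using above[of p v] p 3 by auto
    qed
    ultimately have "u v = p" using p(1) by linarith
    also have "p = w_perm k m v" using 3 unfolding p_def w_perm_def by simp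
    finally show ?thesis .
  qed
qed

text \<open>A letter \<open>l\<close> moves a value above \<open>l\<close> into the first \<open>l\<close> positions, and no other letter can undo
  this; hence a Demazure product fixing \<open>1, \<dots>, k\<close> involves only letters above \<open>k\<close>.\<close>

lemma rank_count_demazure_inv_letter:
  assumes "set a \<subseteq> {1..<m}" "l \<in> set a"
  shows "0 < rank_count (demazure_inv a) l l"
  using assms
proof (induction a)
  case (Cons i a)
  have i: "1 \<le> i" using Cons.prems by simp
  have a: "demazure_inv a permutes {1..m}" using Cons.prems by (intro demazure_inv_permutes) simp
  show ?case
  proof (cases "i = l")
    case True
    have "0 < rank_count (demazure_inv a) l (Suc l)"
    proof (rule ccontr)
      assume "\<not> ?thesis"
      then have "{v \<in> {1..Suc l}. l < demazure_inv a v} = {}" by (simp add: rank_count_card)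
      then have "demazure_inv a ` {1..Suc l} \<subseteq> {1..l}"
        using permutes_in_image[OF a] Cons.prems True by fastforce
      then have "card {1..Suc l} \<le> card {1..l}"
        using permutes_inj[OF a] by (metis card_image card_mono finite_atLeastAtMost inj_on_subset subset_UNIV)
      then show False by simp
    qed
    then show ?thesis using True i by (simp add: rank_count_bubble)
  next
    case False
    then show ?thesis using Cons i by (simp add: rank_count_bubble)
  qed
qed simp

lemma demazure_inv_fixes_below:
  assumes "set a \<subseteq> {k + 1..}" "v \<le> k"
  shows "demazure_inv a v = v"
  using assms by (induction a) (auto simp: bubble_eq_max_min)

lemma demazure_inv_eq_w_perm_iff:
  assumes "k \<le> n" "T \<subseteq> set (positions n)"
  shows "demazure_inv (subword T (positions n)) = w_perm k (Suc n) \<longleftrightarrow>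
    (\<forall>(i, l)\<in>T. k < l) \<and> (\<forall>p\<in>{k..n}. chain_len T p p (k + (Suc n - p)) \<le> k)"
    (is "?d = ?w \<longleftrightarrow> ?A \<and> ?B")
proof -
  let ?a = "subword T (positions n)"
  have setT: "set ?a = snd ` T"
    using assms(2) by (auto simp: subword_def image_iff)
  have letters: "set ?a \<subseteq> {1..<Suc n}"
    using subword_letters[of T "positions n"] by (auto simp: set_positions)
  have rank: "rank_count ?d p (k + (Suc n - p)) = Suc n - p \<longleftrightarrow>
      chain_len T p p (k + (Suc n - p)) \<le> k" if "k \<le> p" "p \<le> n" for p
    using that by (subst rank_count_demazure_inv_subword) auto
  show ?thesis
  proof
    assume eq: "?d = ?w"
    have "k < l" if "(i, l) \<in> T" for i l
    proof (rule ccontr)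
      assume "\<not> k < l"
      then have "{v \<in> {1..l}. l < ?w v} = {}" by (auto simp: w_perm_def)
      then have "rank_count ?d l l = 0" unfolding eq rank_count_card by (simp only: card.empty)
      moreover have "l \<in> set ?a" using that by (force simp: setT)
      ultimately show False using rank_count_demazure_inv_letter[OF letters] by fastforce
    qed
    moreover have "chain_len T p p (k + (Suc n - p)) \<le> k" if "k \<le> p" "p \<le> n" for p
      using rank[OF that] rank_count_w_perm[of k p "Suc n"] that by (simp add: eq)
    ultimately show "?A \<and> ?B" by auto
  next
    assume AB: "?A \<and> ?B"
    show "?d = ?w"
    proof (rule permutes_eq_w_perm)
      show "?d permutes {1..Suc n}" by (rule demazure_inv_permutes[OF letters])
      show "?d v = v" if "v \<in> {1..k}" for v
        using AB that by (intro demazure_inv_fixes_below[where k = k]) (auto simp: setT)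
      show "rank_count ?d p (k + (Suc n - p)) = Suc n - p" if "k \<le> p" "p < Suc n" for p
        using rank[of p] AB that by simp
    qed (use assms in simp)
  qed
qed

section \<open>Chains of cells and crossing diagonals\<close>

text \<open>The diagonals with at least \<open>k\<close> vertices strictly on either side.\<close>

definition long_diagonals :: "nat \<Rightarrow> nat \<Rightarrow> (nat \<times> nat) set"
  where "long_diagonals n k = {(i, j). 1 \<le> i \<and> i + k < j \<and> j \<le> i + n \<and> j \<le> n + k + 1}"

definition crossing_free :: "nat \<Rightarrow> (nat \<times> nat) set \<Rightarrow> bool"
  where "crossing_free k D \<longleftrightarrow>
    \<not> (\<exists>S\<subseteq>D. card S = k + 1 \<and> (\<forall>d\<in>S. \<forall>d'\<in>S. d \<noteq> d' \<longrightarrow> crossing d d'))"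

definition cells :: "nat \<Rightarrow> nat \<Rightarrow> (nat \<times> nat) set"
  where "cells n k = {(i, l). 1 \<le> i \<and> i \<le> l \<and> l \<le> n \<and> k < l}"

definition cell_diagonal :: "nat \<Rightarrow> nat \<Rightarrow> nat \<times> nat \<Rightarrow> nat \<times> nat"
  where "cell_diagonal n k x = (fst x, n + k + 1 + fst x - snd x)"

lemma finite_cells: "finite (cells n k)"
  by (rule finite_subset[of _ "{..n} \<times> {..n}"]) (auto simp: cells_def)

lemma cells_positions: "cells n k \<subseteq> set (positions n)"
  by (auto simp: cells_def set_positions)

lemma inj_cell_diagonal: "inj_on (cell_diagonal n k) (cells n k)"
  by (auto simp: inj_on_def cell_diagonal_def cells_def)

lemma cell_diagonal_image: "cell_diagonal n k ` cells n k = long_diagonals n k"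
proof
  show "cell_diagonal n k ` cells n k \<subseteq> long_diagonals n k"
    by (auto simp: cell_diagonal_def cells_def long_diagonals_def)
  show "long_diagonals n k \<subseteq> cell_diagonal n k ` cells n k"
  proof
    fix d assume d: "d \<in> long_diagonals n k"
    then have "d = cell_diagonal n k (fst d, n + k + 1 + fst d - snd d)"
      by (auto simp: cell_diagonal_def long_diagonals_def)
    moreover have "(fst d, n + k + 1 + fst d - snd d) \<in> cells n k"
      using d by (auto simp: cells_def long_diagonals_def)
    ultimately show "d \<in> cell_diagonal n k ` cells n k" by blast
  qed
qed

lemma card_descending_fst:
  assumes "descending S"
  shows "inj_on fst S" "inj_on snd S"
  using assms by (fastforce simp: descending_def inj_on_def)+

text \<open>In a chain of \<open>k + 1\<close> elements each element has \<open>k\<close> others before or after it, and the borders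
  of the region leave enough room for these only if the element is a cell with a letter in
  \<open>{k + 1..n}\<close>. Positions outside of the triangle therefore do no harm although \<open>gaps\<close> contains
  them.\<close>

lemma descending_gap_cell:
  assumes "k \<le> p" "p \<le> n" "S \<subseteq> gaps T p p (k + (Suc n - p))" "descending S" "card S = k + 1"
    "x \<in> S"
  shows "k < fst x + snd x" "fst x + snd x \<le> n"
proof -
  have fin: "finite S" using assms(5) card_ge_0_finite[of S] by simp
  let ?U = "{y \<in> S. fst x < fst y \<and> snd y < snd x}" and ?L = "{y \<in> S. fst y < fst x \<and> snd x < snd y}"
  have "S - {x} = ?U \<union> ?L" using assms(4,6) by (auto simp: descending_def)
  moreover have "card (S - {x}) = k" using assms(5,6) fin by simp
  moreover have "card (?U \<union> ?L) \<le> card ?U + card ?L" by (rule card_Un_le)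
  ultimately have k: "k \<le> card ?U + card ?L" by simp
  note inj = card_descending_fst[OF assms(4)]
  have in_S: "0 < fst y" "fst y \<le> p" "snd y < k + (Suc n - p)" if "y \<in> S" for y
    using that assms(3) by (auto simp: gaps_def)
  have "card ?U = card (snd ` ?U)" using inj(2) by (intro card_image[symmetric] inj_on_subset[OF inj(2)]) auto
  also have "\<dots> \<le> card {..<snd x}" by (intro card_mono) auto
  finally have U1: "card ?U \<le> snd x" by simp
  have "card ?L = card (fst ` ?L)" by (intro card_image[symmetric] inj_on_subset[OF inj(1)]) auto
  also have "\<dots> \<le> card {1..<fst x}" using in_S by (intro card_mono) (auto simp: Suc_le_eq One_nat_def)
  finally have L1: "card ?L \<le> fst x - 1" by simp
  have "card ?U = card (fst ` ?U)" by (intro card_image[symmetric] inj_on_subset[OF inj(1)]) auto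
  also have "\<dots> \<le> card {fst x<..p}" using in_S by (intro card_mono) auto
  finally have U2: "card ?U \<le> p - fst x" by simp
  have "card ?L = card (snd ` ?L)" by (intro card_image[symmetric] inj_on_subset[OF inj(2)]) auto
  also have "\<dots> \<le> card {snd x<..<k + (Suc n - p)}" using in_S by (intro card_mono) auto
  finally have L2: "card ?L \<le> k + (Suc n - p) - Suc (snd x)" by simp
  show "k < fst x + snd x" using k U1 L1 in_S(1)[OF assms(6)] by linarith
  show "fst x + snd x \<le> n" using k U2 L2 in_S(2,3)[OF assms(6)] assms(1,2) by linarith
qed

text \<open>A chain in the region of \<open>p\<close> has left end points up to \<open>p\<close> and right end points above \<open>p\<close>, so its
  diagonals cross pairwise. Conversely, the largest left end point of a pairwise crossing family
  can serve as \<open>p\<close>.\<close>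

lemma chain_len_iff_crossing_free:
  assumes "k \<le> n" "T \<subseteq> cells n k"
  shows "(\<forall>p\<in>{k..n}. chain_len T p p (k + (Suc n - p)) \<le> k) \<longleftrightarrow>
    crossing_free k (long_diagonals n k - cell_diagonal n k ` T)"
    (is "?A \<longleftrightarrow> crossing_free k ?L")
proof -
  have "\<not> ?A \<longleftrightarrow> \<not> crossing_free k ?L"
  proof
    assume "\<not> ?A"
    then obtain p where p: "k \<le> p" "p \<le> n" "k < chain_len T p p (k + (Suc n - p))" by auto
    obtain S' where S': "S' \<subseteq> gaps T p p (k + (Suc n - p))" "descending S'"
      "card S' = chain_len T p p (k + (Suc n - p))"
      using descending_exists[of p p T] by blast
    obtain S where S: "S \<subseteq> S'" "card S = k + 1"
      using obtain_subset_with_card_n[of "k + 1" S'] p(3) S'(3) by auto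
    have desc: "descending S" using descending_subset[OF S'(2) S(1)] .
    have gap: "S \<subseteq> gaps T p p (k + (Suc n - p))" using S S' by auto
    define f where "f x = (fst x, n + k + 1 - snd x)" for x :: "nat \<times> nat"
    have cross: "crossing (f x) (f y)" if "x \<in> S" "y \<in> S" "x \<noteq> y" for x y
    proof -
      have "fst x \<le> p" "fst y \<le> p" "snd x < k + (Suc n - p)" "snd y < k + (Suc n - p)"
        using gap that by (auto simp: gaps_def)
      then show ?thesis
        using desc that p(1,2) unfolding descending_def f_def crossing_def by fastforce
    qed
    have inj: "inj_on f S"
    proof (rule inj_onI)
      fix x y assume "x \<in> S" "y \<in> S" "f x = f y"
      then show "x = y" using cross[of x y] by (auto simp: crossing_def)
    qed
    have sub: "f ` S \<subseteq> ?L"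
    proof
      fix d assume "d \<in> f ` S"
      then obtain x where x: "x \<in> S" "d = f x" by blast
      have b: "k < fst x + snd x" "fst x + snd x \<le> n"
        using descending_gap_cell[OF p(1,2) gap desc S(2) x(1)] by auto
      have g: "0 < fst x" "(fst x, fst x + snd x) \<notin> T" using gap x(1) by (auto simp: gaps_def)
      have c: "(fst x, fst x + snd x) \<in> cells n k"
        using b g by (auto simp: cells_def One_nat_def)
      have d: "d = cell_diagonal n k (fst x, fst x + snd x)"
        using x(2) by (simp add: f_def cell_diagonal_def)
      have "d \<notin> cell_diagonal n k ` T"
        unfolding d using g(2) c assms(2) inj_on_image_mem_iff[OF inj_cell_diagonal c assms(2)] by simp
      then show "d \<in> ?L" using c d cell_diagonal_image[of n k] by blast
    qed
    have card: "card (f ` S) = k + 1" using card_image[OF inj] S(2) by simp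
    have "crossing d d'" if "d \<in> f ` S" "d' \<in> f ` S" "d \<noteq> d'" for d d'
      using that cross by blast
    then show "\<not> crossing_free k ?L"
      unfolding crossing_free_def not_not by (intro exI[of _ "f ` S"] conjI ballI impI sub card)
  next
    assume "\<not> crossing_free k ?L"
    then obtain S where S: "S \<subseteq> ?L" "card S = k + 1"
      "\<And>d d'. d \<in> S \<Longrightarrow> d' \<in> S \<Longrightarrow> d \<noteq> d' \<Longrightarrow> crossing d d'"
      unfolding crossing_free_def by blast
    have fin: "finite S" using S(2) card_ge_0_finite[of S] by simp
    have ne: "S \<noteq> {}" using S(2) by auto
    have long: "1 \<le> fst d" "fst d + k < snd d" "snd d \<le> fst d + n" "snd d \<le> n + k + 1"
      "d \<notin> cell_diagonal n k ` T" if "d \<in> S" for d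
      using S(1) that by (auto simp: long_diagonals_def)
    define p where "p = Max (fst ` S)"
    have "p \<in> fst ` S" unfolding p_def using fin ne by (intro Max_in) auto
    then obtain d0 where d0: "d0 \<in> S" "fst d0 = p" by (metis imageE)
    have le: "fst d \<le> p" if "d \<in> S" for d
      using that fin by (simp add: p_def)
    have gt: "p < snd d" if "d \<in> S" for d
      using S(3)[OF that d0(1)] le[OF that] d0 long(2)[OF that]
      by (cases "d = d0") (auto simp: crossing_def)
    have "inj_on fst S" using S(3) by (fastforce simp: inj_on_def crossing_def)
    then have "card (fst ` S) = k + 1" using S(2) by (simp add: card_image)
    moreover have "fst ` S \<subseteq> {1..p}" using le long by auto
    then have "card (fst ` S) \<le> card {1..p}" by (intro card_mono) auto
    ultimately have kp: "k < p" by simp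
    have pn: "p \<le> n" using long(2,4)[OF d0(1)] d0(2) by simp
    define f where "f d = (fst d, n + k + 1 - snd d)" for d :: "nat \<times> nat"
    have desc: "descending (f ` S)"
    proof -
      have "(fst x < fst y \<and> snd (f y) < snd (f x)) \<or> (fst y < fst x \<and> snd (f x) < snd (f y))"
        if "x \<in> S" "y \<in> S" "x \<noteq> y" for x y
        using S(3)[OF that] long(4)[OF that(1)] long(4)[OF that(2)]
        by (auto simp: crossing_def f_def)
      then show ?thesis unfolding descending_def by (fastforce simp: f_def)
    qed
    have "inj_on f S"
      using \<open>inj_on fst S\<close> by (auto simp: inj_on_def f_def)
    then have card: "card (f ` S) = k + 1" using S(2) by (simp add: card_image)
    have "f ` S \<subseteq> gaps T p p (k + (Suc n - p))"
    proof
      fix x assume "x \<in> f ` S"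
      then obtain d where d: "d \<in> S" "x = f d" by blast
      have "(fst x, fst x + snd x) \<notin> T"
      proof
        assume "(fst x, fst x + snd x) \<in> T"
        then have "cell_diagonal n k (fst x, fst x + snd x) \<in> cell_diagonal n k ` T" by blast
        moreover have "cell_diagonal n k (fst x, fst x + snd x) = d"
          using long[OF d(1)] d(2) by (auto simp: cell_diagonal_def f_def prod_eq_iff)
        ultimately show False using long(5)[OF d(1)] by simp
      qed
      moreover have "0 < fst x" "fst x \<le> p" "snd x < k + (Suc n - p)"
        using long[OF d(1)] le[OF d(1)] gt[OF d(1)] pn d(2) by (auto simp: f_def)
      ultimately show "x \<in> gaps T p p (k + (Suc n - p))" by (auto simp: gaps_def)
    qed
    from card_descending_le[OF order_refl this desc] have "k < chain_len T p p (k + (Suc n - p))"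
      using card by simp
    then show "\<not> ?A" using kp pn by (auto intro!: bexI[of _ p])
  qed
  then show ?thesis by blast
qed

section \<open>Counting cells\<close>

lemma card_cells:
  "card (cells n k) = (\<Sum>l = k + 1..n. l)"
proof -
  have "cells n k = prod.swap ` (SIGMA l:{k + 1..n}. {1..l})"
    by (fastforce simp: cells_def image_iff)
  moreover have "inj_on prod.swap (SIGMA l:{k + 1..n}. {1..l})"
    by (auto simp: inj_on_def)
  ultimately have "card (cells n k) = card (SIGMA l:{k + 1..n}. {1..l})"
    by (simp only: card_image)
  then show ?thesis by simp
qed

lemma inversions_w_perm: "inversions m (w_perm k m) = (\<Sum>l = k + 1..m - 1. l - k)"
proof -
  have "{(a, b). 1 \<le> a \<and> a < b \<and> b \<le> m \<and> w_perm k m b < w_perm k m a} =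
      {(a, b). k < a \<and> a < b \<and> b \<le> m}"
    by (auto simp: w_perm_def split: if_splits)
  also have "\<dots> = (\<lambda>(l, a). (a, Suc l)) ` (SIGMA l:{k + 1..m - 1}. {k<..l})"
  proof (intro equalityI subsetI)
    fix x :: "nat \<times> nat"
    assume x: "x \<in> {(a, b). k < a \<and> a < b \<and> b \<le> m}"
    then have "x = (\<lambda>(l, a). (a, Suc l)) (snd x - 1, fst x)"
      "(snd x - 1, fst x) \<in> (SIGMA l:{k + 1..m - 1}. {k<..l})" by auto
    then show "x \<in> (\<lambda>(l, a). (a, Suc l)) ` (SIGMA l:{k + 1..m - 1}. {k<..l})" by blast
  qed auto
  finally have "inversions m (w_perm k m) =
      card ((\<lambda>(l, a). (a, Suc l)) ` (SIGMA l:{k + 1..m - 1}. {k<..l}))"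
    by (simp add: inversions_def)
  also have "\<dots> = card (SIGMA l:{k + 1..m - 1}. {k<..l})"
    by (rule card_image) (auto simp: inj_on_def)
  finally show ?thesis by simp
qed

text \<open>There are \<open>l\<close> cells with letter \<open>l\<close>, and \<open>l - k\<close> inversions with second position \<open>l + 1\<close>. The
  excess of the cells is the exponent of beta in the prefactor of the identity.\<close>

lemma card_cells_inversions:
  assumes "k \<le> n"
  shows "card (cells n k) = k * (n - k) + inversions (Suc n) (w_perm k (Suc n))"
proof -
  have "(\<Sum>l = k + 1..n. l) = (\<Sum>l = k + 1..n. k + (l - k))"
    by (intro sum.cong) auto
  also have "\<dots> = (n - k) * k + (\<Sum>l = k + 1..n. l - k)"
    unfolding sum.distrib by simp
  finally show ?thesis by (simp add: card_cells inversions_w_perm)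
qed

lemma prod_cells:
  fixes x :: "nat \<Rightarrow> 'a::comm_monoid_mult"
  assumes "k \<le> n"
  shows "(\<Prod>c\<in>cells n k. x (fst c)) = (\<Prod>a = 1..n. x a ^ min (n - a + 1) (n - k))"
proof -
  have "cells n k = (SIGMA a:{1..n}. {max a (k + 1)..n})"
    by (auto simp: cells_def)
  moreover have "(\<Prod>a = 1..n. \<Prod>l = max a (k + 1)..n. x a) =
      (\<Prod>(a, l)\<in>(SIGMA a:{1..n}. {max a (k + 1)..n}). x a)"
    by (rule prod.Sigma) auto
  ultimately have "(\<Prod>c\<in>cells n k. x (fst c)) = (\<Prod>a = 1..n. \<Prod>l = max a (k + 1)..n. x a)"
    by (simp only: split_def)
  also have "\<dots> = (\<Prod>a = 1..n. x a ^ min (n - a + 1) (n - k))"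
  proof (intro prod.cong refl)
    fix a assume "a \<in> {1..n}"
    then have "card {max a (k + 1)..n} = min (n - a + 1) (n - k)" by auto
    then show "(\<Prod>l = max a (k + 1)..n. x a) = x a ^ min (n - a + 1) (n - k)"
      by (simp only: prod_constant)
  qed
  finally show ?thesis .
qed

section \<open>Dissections\<close>

lemma minimal_dissection_iff:
  assumes "k \<le> n"
  shows "(i, j) \<in> minimal_dissection k (n + k + 1) \<longleftrightarrow>
    1 \<le> i \<and> j \<le> n + k + 1 \<and> ((i + 2 \<le> j \<and> j \<le> i + k) \<or> (i + n < j \<and> j + 2 \<le> i + (n + k + 1)))"
    (is "_ \<longleftrightarrow> ?R")
proof -
  let ?N = "n + k + 1"
  have cyc: "cyc ?N (a + r) = (if a + r \<le> ?N then a + r else a + r - ?N)"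
    if "a \<in> {1..?N}" "r \<in> {2..k}" for a r
  proof (cases "a + r \<le> ?N")
    case True
    then show ?thesis using that by (simp add: cyc_def)
  next
    case False
    define c where "c = a + r - 1 - ?N"
    have "a + r - 1 = ?N + c" "c < ?N" using that assms False by (auto simp: c_def)
    then have "(a + r - 1) mod ?N = c" by simp
    moreover have "c = a + r - ?N - 1" by (simp add: c_def)
    ultimately show ?thesis using False that by (simp add: cyc_def)
  qed
  show ?thesis
  proof
    assume "(i, j) \<in> minimal_dissection k ?N"
    then obtain a r where ar: "i < j" "a \<in> {1..?N}" "r \<in> {2..k}" "{i, j} = {a, cyc ?N (a + r)}"
      by (auto simp: minimal_dissection_def)
    then show ?R
      unfolding cyc[OF ar(2,3)] using assms by (auto simp: doubleton_eq_iff split: if_splits)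
  next
    assume R: ?R
    then consider "i + 2 \<le> j" "j \<le> i + k" | "i + n < j" "j + 2 \<le> i + ?N" by blast
    then have "\<exists>a\<in>{1..?N}. \<exists>r\<in>{2..k}. {i, j} = {a, cyc ?N (a + r)}"
    proof cases
      case 1
      then have "i \<in> {1..?N}" "j - i \<in> {2..k}" using R by auto
      moreover have "cyc ?N (i + (j - i)) = j"
        using cyc[OF calculation] R 1 by simp
      ultimately show ?thesis by metis
    next
      case 2
      then have *: "j \<in> {1..?N}" "i + ?N - j \<in> {2..k}" using R by auto
      moreover have "cyc ?N (j + (i + ?N - j)) = i"
        using cyc[OF *] R 2 by auto
      ultimately show ?thesis by (metis insert_commute)
    qed
    then show "(i, j) \<in> minimal_dissection k ?N"
      using R assms by (auto simp: minimal_dissection_def)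
  qed
qed

lemma diagonals_split:
  assumes "0 < k" "k \<le> n"
  shows "diagonals (n + k + 1) = minimal_dissection k (n + k + 1) \<union> long_diagonals n k"
    "minimal_dissection k (n + k + 1) \<inter> long_diagonals n k = {}"
proof -
  show "diagonals (n + k + 1) = minimal_dissection k (n + k + 1) \<union> long_diagonals n k"
    using assms by (auto simp: diagonals_def long_diagonals_def minimal_dissection_iff)
  show "minimal_dissection k (n + k + 1) \<inter> long_diagonals n k = {}"
    using assms by (auto simp: long_diagonals_def minimal_dissection_iff)
qed

text \<open>The \<open>k\<close> other diagonals of a pairwise crossing family have distinct end points, one on either
  side of the given diagonal.\<close>

lemma crossing_set_long:
  assumes S: "S \<subseteq> diagonals (n + k + 1)" "card S = k + 1"
    and cross: "\<forall>d\<in>S. \<forall>d'\<in>S. d \<noteq> d' \<longrightarrow> crossing d d'"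
  shows "S \<subseteq> long_diagonals n k"
proof
  fix d assume d: "d \<in> S"
  let ?N = "n + k + 1"
  have fin: "finite S" using S(2) card_ge_0_finite[of S] by simp
  have in_N: "1 \<le> fst x \<and> snd x \<le> ?N" if "x \<in> S" for x
    using that S(1) by (auto simp: diagonals_def)
  define inner where "inner x = (if fst d < fst x then fst x else snd x)" for x :: "nat \<times> nat"
  define outer where "outer x = (if fst d < fst x then snd x else fst x)" for x :: "nat \<times> nat"
  have cr: "crossing x y" if "x \<in> S" "y \<in> S" "x \<noteq> y" for x y using cross that by blast
  have distinct: "fst x \<noteq> fst y \<and> snd x \<noteq> snd y \<and> fst x \<noteq> snd y \<and> snd x \<noteq> fst y"
    if "x \<in> S" "y \<in> S" "x \<noteq> y" for x y
    using cr[OF that] by (auto simp: crossing_def)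
  have "inj_on inner (S - {d})"
    by (rule inj_onI) (use distinct in \<open>fastforce simp: inner_def split: if_splits\<close>)
  moreover have "inner x \<in> {fst d<..<snd d}" if "x \<in> S - {d}" for x
    using cr[of d x] that d by (auto simp: inner_def crossing_def)
  then have "inner ` (S - {d}) \<subseteq> {fst d<..<snd d}" by blast
  ultimately have "card (S - {d}) \<le> card {fst d<..<snd d}"
    by (metis card_inj_on_le finite_greaterThanLessThan)
  moreover have "fst d + 2 \<le> snd d" using S(1) d by (auto simp: diagonals_def)
  ultimately have 1: "fst d + k < snd d" using S(2) d fin by simp
  have "inj_on outer (S - {d})"
    by (rule inj_onI) (use distinct in \<open>fastforce simp: outer_def split: if_splits\<close>)
  moreover have "outer x \<in> {1..<fst d} \<union> {snd d<..?N}" if "x \<in> S - {d}" for x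
    using cr[of d x] that d in_N[of x] by (auto simp: outer_def crossing_def)
  then have "outer ` (S - {d}) \<subseteq> {1..<fst d} \<union> {snd d<..?N}" by blast
  ultimately have "card (S - {d}) \<le> card ({1..<fst d} \<union> {snd d<..?N})"
    by (intro card_inj_on_le[of outer]) auto
  also have "\<dots> \<le> (fst d - 1) + (?N - snd d)"
    using card_Un_le[of "{1..<fst d}" "{snd d<..?N}"] by simp
  finally have 2: "k \<le> (fst d - 1) + (?N - snd d)" using S(2) d fin by simp
  show "d \<in> long_diagonals n k"
    using 1 2 in_N[OF d] by (auto simp: long_diagonals_def split_def)
qed

text \<open>The diagonals from \<open>v\<close> to \<open>v + r\<close> and to \<open>v - r\<close> modulo \<open>n + k + 1\<close>, for \<open>r\<close> in \<open>{2..k}\<close>, are all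
  distinct because \<open>2 * k < n + k + 1\<close>.\<close>

lemma minimal_dissection_degree:
  assumes "k \<le> n" "v \<in> {1..n + k + 1}"
  shows "2 * (k - 1) \<le> card {d \<in> minimal_dissection k (n + k + 1). v = fst d \<or> v = snd d}"
proof -
  let ?N = "n + k + 1" and ?M = "minimal_dissection k (n + k + 1)"
  define up where "up r = (if v + r \<le> ?N then (v, v + r) else (v + r - ?N, v))" for r
  define down where "down r = (if r < v then (v - r, v) else (v, v + ?N - r))" for r
  let ?D = "{d \<in> ?M. v = fst d \<or> v = snd d}"
  have "?D \<subseteq> {..?N} \<times> {..?N}"
    using assms(1) by (auto simp: minimal_dissection_iff)
  then have fin: "finite ?D" by (rule finite_subset) simp
  have "up ` {2..k} \<union> down ` {2..k} \<subseteq> ?D"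
    using assms by (auto simp: up_def down_def minimal_dissection_iff)
  then have "card (up ` {2..k} \<union> down ` {2..k}) \<le> card ?D" by (rule card_mono[OF fin])
  moreover have "up ` {2..k} \<inter> down ` {2..k} = {}"
    using assms by (auto simp: up_def down_def split: if_splits)
  then have "card (up ` {2..k} \<union> down ` {2..k}) = card (up ` {2..k}) + card (down ` {2..k})"
    by (intro card_Un_disjoint) auto
  moreover have "inj_on up {2..k}" "inj_on down {2..k}"
    using assms by (auto simp: inj_on_def up_def down_def split: if_splits)
  then have "card (up ` {2..k}) = k - 1" "card (down ` {2..k}) = k - 1"
    by (simp_all add: card_image)
  ultimately show ?thesis by simp
qed

lemma dissection_iff:
  assumes "0 < k" "k \<le> n"
  shows "dissection k (n + k + 1) D \<longleftrightarrow>
    (\<exists>L\<subseteq>long_diagonals n k. crossing_free k L \<and> D = minimal_dissection k (n + k + 1) \<union> L)"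
proof
  let ?M = "minimal_dissection k (n + k + 1)"
  assume D: "dissection k (n + k + 1) D"
  have "D - ?M \<subseteq> long_diagonals n k"
    using D diagonals_split[OF assms] by (auto simp: dissection_def)
  moreover have "crossing_free k (D - ?M)"
    using D unfolding dissection_def crossing_free_def by blast
  moreover have "D = ?M \<union> (D - ?M)" using D by (auto simp: dissection_def)
  ultimately show "\<exists>L\<subseteq>long_diagonals n k. crossing_free k L \<and> D = ?M \<union> L" by blast
next
  let ?M = "minimal_dissection k (n + k + 1)"
  assume "\<exists>L\<subseteq>long_diagonals n k. crossing_free k L \<and> D = ?M \<union> L"
  then obtain L where L: "L \<subseteq> long_diagonals n k" "crossing_free k L" "D = ?M \<union> L" by blast
  have sub: "D \<subseteq> diagonals (n + k + 1)" using L diagonals_split[OF assms] by auto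
  have fin: "finite D"
    by (rule finite_subset[OF sub], rule finite_subset[of _ "{..n + k + 1} \<times> {..n + k + 1}"])
      (auto simp: diagonals_def)
  have "\<not> (\<exists>S\<subseteq>D. card S = k + 1 \<and> (\<forall>d\<in>S. \<forall>d'\<in>S. d \<noteq> d' \<longrightarrow> crossing d d'))"
  proof
    assume "\<exists>S\<subseteq>D. card S = k + 1 \<and> (\<forall>d\<in>S. \<forall>d'\<in>S. d \<noteq> d' \<longrightarrow> crossing d d')"
    then obtain S where S: "S \<subseteq> D" "card S = k + 1" "\<forall>d\<in>S. \<forall>d'\<in>S. d \<noteq> d' \<longrightarrow> crossing d d'"
      by blast
    have "S \<subseteq> long_diagonals n k"
      using crossing_set_long[OF _ S(2,3)] S(1) sub by blast
    then have "S \<subseteq> L" using S(1) L(3) diagonals_split(2)[OF assms] by blast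
    then show False using L(2) S unfolding crossing_free_def by blast
  qed
  moreover have "2 * (k - 1) \<le> card {d \<in> D. v = fst d \<or> v = snd d}" if "v \<in> {1..n + k + 1}" for v
  proof -
    have "card {d \<in> ?M. v = fst d \<or> v = snd d} \<le> card {d \<in> D. v = fst d \<or> v = snd d}"
      using L(3) fin by (intro card_mono) auto
    then show ?thesis using minimal_dissection_degree[OF assms(2) that] by simp
  qed
  ultimately show "dissection k (n + k + 1) D"
    using sub L(3) by (auto simp: dissection_def)
qed

lemma dissection_poly_eq:
  assumes "0 < k" "k \<le> n"
  shows "dissection_poly k (n + k + 1) =
    (\<Sum>L | L \<subseteq> long_diagonals n k \<and> crossing_free k L. beta ^ card L * (\<Prod>d\<in>L. var (fst d)))"
proof -
  let ?M = "minimal_dissection k (n + k + 1)"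
  let ?F = "{L. L \<subseteq> long_diagonals n k \<and> crossing_free k L}"
  have diff: "(?M \<union> L) - ?M = L" if "L \<in> ?F" for L
    using that diagonals_split(2)[OF assms] by blast
  have "{D. dissection k (n + k + 1) D} = (\<union>) ?M ` ?F"
    by (auto simp: dissection_iff[OF assms])
  moreover have "inj_on ((\<union>) ?M) ?F"
    by (rule inj_onI) (metis diff)
  ultimately have "dissection_poly k (n + k + 1) =
      (\<Sum>L\<in>?F. beta ^ card ((?M \<union> L) - ?M) * (\<Prod>d\<in>(?M \<union> L) - ?M. var (fst d)))"
    by (simp add: dissection_poly_def sum.reindex)
  also have "\<dots> = (\<Sum>L\<in>?F. beta ^ card L * (\<Prod>d\<in>L. var (fst d)))"
    by (intro sum.cong refl) (simp only: diff)
  finally show ?thesis .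
qed

lemma grothendieck_w_perm:
  assumes "k \<le> n"
  shows "grothendieck (n + 1) (w_perm k (n + 1)) =
    (\<Sum>T | T \<subseteq> cells n k \<and> crossing_free k (long_diagonals n k - cell_diagonal n k ` T).
       beta ^ (card T - inversions (Suc n) (w_perm k (Suc n))) * (\<Prod>x\<in>T. var (fst x)))"
proof -
  have "{T. T \<subseteq> set (positions n) \<and> demazure_inv (subword T (positions n)) = w_perm k (Suc n)} =
      {T. T \<subseteq> cells n k \<and> crossing_free k (long_diagonals n k - cell_diagonal n k ` T)}"
  proof (intro Collect_cong iffI conjI; elim conjE)
    fix T
    assume T: "T \<subseteq> set (positions n)" "demazure_inv (subword T (positions n)) = w_perm k (Suc n)"
    show 1: "T \<subseteq> cells n k"
      using T demazure_inv_eq_w_perm_iff[OF assms T(1)] by (fastforce simp: set_positions cells_def)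
    show "crossing_free k (long_diagonals n k - cell_diagonal n k ` T)"
      using T demazure_inv_eq_w_perm_iff[OF assms T(1)] chain_len_iff_crossing_free[OF assms 1] by blast
  next
    fix T
    assume T: "T \<subseteq> cells n k" "crossing_free k (long_diagonals n k - cell_diagonal n k ` T)"
    show 1: "T \<subseteq> set (positions n)" using T(1) cells_positions by blast
    have "\<forall>(i, l)\<in>T. k < l" using T(1) by (auto simp: cells_def)
    then show "demazure_inv (subword T (positions n)) = w_perm k (Suc n)"
      using T(2) demazure_inv_eq_w_perm_iff[OF assms 1] chain_len_iff_crossing_free[OF assms T(1)] by blast
  qed
  then show ?thesis
    using grothendieck_eq_sum[OF w_perm_permutes[of k "Suc n"]] by (simp add: inv_w_perm flip: Suc_eq_plus1)
qed

section \<open>The identity\<close>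

lemma to_fract_sum: "to_fract (\<Sum>x\<in>A. f x) = (\<Sum>x\<in>A. to_fract (f x))"
  by (induction A rule: infinite_finite_induct) simp_all

lemma to_fract_prod: "to_fract (\<Prod>x\<in>A. f x) = (\<Prod>x\<in>A. to_fract (f x))"
  by (induction A rule: infinite_finite_induct) simp_all

lemma to_fract_power: "to_fract (x ^ e) = to_fract x ^ e"
  by (induction e) simp_all

lemma var_nonzero: "var i \<noteq> 0"
  unfolding var_def by (metis lookup_single_eq lookup_zero zero_neq_one)

theorem theorem5p6:
  fixes n k :: nat
  assumes "0 < k" and "k \<le> n"
  shows "to_fract (dissection_poly k (n + k + 1)) =
    to_fract beta ^ (k * (n - k)) *
    (\<Prod>a = 1..n. to_fract (var a) ^ min (n - a + 1) (n - k)) *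
    subst_bx (inverse (to_fract beta)) (\<lambda>i. inverse (to_fract (var i)))
      (grothendieck (n + 1) (w_perm k (n + 1)))"
proof -
  define b where "b = to_fract beta"
  define x where "x i = to_fract (var i)" for i
  define len where "len = inversions (Suc n) (w_perm k (Suc n))"
  let ?F = "{T. T \<subseteq> cells n k \<and> crossing_free k (long_diagonals n k - cell_diagonal n k ` T)}"
  let ?G = "{L. L \<subseteq> long_diagonals n k \<and> crossing_free k L}"
  have b0: "b \<noteq> 0" and x0: "x i \<noteq> 0" for i
    using beta_nonzero var_nonzero by (simp_all add: b_def x_def)
  have fin: "finite T" if "T \<subseteq> cells n k" for T
    using that finite_cells finite_subset by blast
  have len_le: "len \<le> card T" if "T \<in> ?F" for T
  proof -
    have T: "T \<subseteq> set (positions n)" "T \<subseteq> cells n k" using that cells_positions by auto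
    have "demazure_inv (subword T (positions n)) = w_perm k (Suc n)"
      using that demazure_inv_eq_w_perm_iff[OF assms(2) T(1)] chain_len_iff_crossing_free[OF assms(2) T(2)]
      by (auto simp: cells_def)
    moreover have "set (subword T (positions n)) \<subseteq> {1..<Suc n}"
      using subword_letters[of T "positions n"] by (auto simp: set_positions)
    ultimately show ?thesis
      using inversions_demazure_inv_le length_subword[OF distinct_positions T(1)] unfolding len_def by metis
  qed
  have compl: "b ^ (k * (n - k)) * (\<Prod>c\<in>cells n k. x (fst c)) *
      (inverse b ^ (card T - len) * (\<Prod>c\<in>T. inverse (x (fst c)))) =
      b ^ card (cells n k - T) * (\<Prod>c\<in>cells n k - T. x (fst c))" if T: "T \<in> ?F" for T
  proof -
    have sub: "T \<subseteq> cells n k" using T by simp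
    (* The exponent of beta is not truncated, as T has at least as many cells as the permutation has inversions. *)
    have "card (cells n k - T) + (card T - len) = k * (n - k)"
      using card_Diff_subset[OF fin[OF sub] sub] card_mono[OF finite_cells sub] len_le[OF T]
        card_cells_inversions[OF assms(2)] unfolding len_def by linarith
    then have bs: "b ^ (k * (n - k)) = b ^ card (cells n k - T) * b ^ (card T - len)"
      by (metis power_add)
    have b1: "b ^ (card T - len) * inverse b ^ (card T - len) = 1"
      using b0 by (simp flip: power_mult_distrib)
    have xs: "(\<Prod>c\<in>cells n k. x (fst c)) = (\<Prod>c\<in>cells n k - T. x (fst c)) * (\<Prod>c\<in>T. x (fst c))"
      by (rule prod.subset_diff[OF sub finite_cells])
    have x1: "(\<Prod>c\<in>T. x (fst c)) * (\<Prod>c\<in>T. inverse (x (fst c))) = 1"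
      using x0 by (simp flip: prod.distrib)
    have "p * q * (r * s) * (q' * s') = p * r * ((q * q') * (s * s'))"
      for p q r s q' s' :: "bxpoly fract"
      by (simp only: mult_ac)
    then show ?thesis unfolding bs xs by (simp only: b1 x1 mult_1_right)
  qed
  (* The set T corresponds to the dissection formed by the cells outside of T. *)
  define \<phi> where "\<phi> T = cell_diagonal n k ` (cells n k - T)" for T
  have \<phi>: "\<phi> T = long_diagonals n k - cell_diagonal n k ` T" if "T \<subseteq> cells n k" for T
    unfolding \<phi>_def using that
    by (simp add: inj_on_image_set_diff[OF inj_cell_diagonal] cell_diagonal_image)
  have mem: "cell_diagonal n k c \<in> \<phi> T \<longleftrightarrow> c \<notin> T" if "c \<in> cells n k" for c T
    using inj_on_image_mem_iff[OF inj_cell_diagonal that, of "cells n k - T"] that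
    by (simp add: \<phi>_def)
  have inv: "\<phi> {c \<in> cells n k. cell_diagonal n k c \<notin> L} = L" if L: "L \<in> ?G" for L
  proof -
    have "\<phi> {c \<in> cells n k. cell_diagonal n k c \<notin> L} = cell_diagonal n k ` cells n k \<inter> L"
      unfolding \<phi>_def by blast
    then show ?thesis using L by (simp add: cell_diagonal_image Int_absorb1)
  qed
  have bij: "bij_betw \<phi> ?F ?G"
  proof (rule bij_betw_byWitness[where f' = "\<lambda>L. {c \<in> cells n k. cell_diagonal n k c \<notin> L}"])
    show "\<forall>T\<in>?F. {c \<in> cells n k. cell_diagonal n k c \<notin> \<phi> T} = T"
      using mem by blast
    show "\<forall>L\<in>?G. \<phi> {c \<in> cells n k. cell_diagonal n k c \<notin> L} = L"
      using inv by blast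
    show "\<phi> ` ?F \<subseteq> ?G" using \<phi> by auto
    show "(\<lambda>L. {c \<in> cells n k. cell_diagonal n k c \<notin> L}) ` ?G \<subseteq> ?F"
    proof (intro image_subsetI CollectI conjI)
      fix L assume L: "L \<in> ?G"
      show sub: "{c \<in> cells n k. cell_diagonal n k c \<notin> L} \<subseteq> cells n k" by auto
      show "crossing_free k (long_diagonals n k -
          cell_diagonal n k ` {c \<in> cells n k. cell_diagonal n k c \<notin> L})"
        using inv[OF L] L \<phi>[OF sub] by simp
    qed
  qed
  have fst_diag: "fst (cell_diagonal n k c) = fst c" for c
    by (simp add: cell_diagonal_def)
  have inj: "inj_on (cell_diagonal n k) (cells n k - T)" for T
    by (rule inj_on_subset[OF inj_cell_diagonal]) auto
  have "to_fract (dissection_poly k (n + k + 1)) = (\<Sum>L\<in>?G. b ^ card L * (\<Prod>d\<in>L. x (fst d)))"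
    by (simp add: dissection_poly_eq[OF assms] to_fract_sum to_fract_prod to_fract_power b_def x_def)
  also have "\<dots> = (\<Sum>T\<in>?F. b ^ card (\<phi> T) * (\<Prod>d\<in>\<phi> T. x (fst d)))"
    by (rule sum.reindex_bij_betw[OF bij, symmetric])
  also have "\<dots> = (\<Sum>T\<in>?F. b ^ card (cells n k - T) * (\<Prod>c\<in>cells n k - T. x (fst c)))"
    by (simp add: \<phi>_def card_image[OF inj] prod.reindex[OF inj] fst_diag)
  also have "\<dots> = (\<Sum>T\<in>?F. b ^ (k * (n - k)) * (\<Prod>c\<in>cells n k. x (fst c)) *
      (inverse b ^ (card T - len) * (\<Prod>c\<in>T. inverse (x (fst c)))))"
    by (intro sum.cong refl compl[symmetric])
  also have "\<dots> = b ^ (k * (n - k)) * (\<Prod>c\<in>cells n k. x (fst c)) *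
      subst_bx (inverse b) (\<lambda>i. inverse (x i)) (grothendieck (n + 1) (w_perm k (n + 1)))"
    unfolding grothendieck_w_perm[OF assms(2)] subst_bx_sum len_def[symmetric] sum_distrib_left
    by (intro sum.cong refl) (simp add: subst_bx_monomial fin)
  finally show ?thesis
    unfolding prod_cells[OF assms(2)] by (simp only: b_def x_def)
qed

end
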